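(* Let $Y$ be a Banach space and let $\omega:(0,\infty)\to(0,\infty)$ be a non-decreasing function such that $\lim_{t\to 0}\omega(t)=0$, $\lim_{t\to\infty}\omega(t)=\infty$, and, for some constant $C_{\mathrm{db}}>1$, $\omega(2t)\le C_{\mathrm{db}}\,\omega(t)$ for all $t\in(0,\infty)$. Let $G\subset_u\dot{\mathrm{VC}}^{0,\omega}(\mathbb R^n,Y)$. Then: (1) for all $L>0$, $\{f\circ\tau_L:f\in G\}\subset_u\dot{\mathrm{VC}}^{0,\omega}(\mathbb R^n,Y)$; (2) for all $L,L'>0$, $\{(f\circ\tau_L)*\eta_{L'}:f\in G\}\subset_u\dot{\mathrm{VC}}^{0,\omega}(\mathbb R^n,Y)$; (3) for every $\varepsilon>0$, for all sufficiently large $M=M(\varepsilon)>0$, $$\sup_{f\in G}\|f-f\circ\tau_M\|_{\dot C^{0,\omega}(\mathbb R^n,Y)}\le\varepsilon;$$ (4) for every $\varepsilon>0$ and $M>0$, for all sufficiently large $K=K(M,\varepsilon)>0$, $$\sup_{f\in G}\|f\circ\tau_M-(f\circ\tau_M)*\eta_{1/K}\|_{\dot C^{0,\omega}(\mathbb R^n,Y)}\le\varepsilon.$$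
   Context: Here $n\ge1$ and $X=\mathbb R^n$ carries the Euclidean norm $|\cdot|$. $\dot C^{0,\omega}(X,Y)$ is the set of $f:X\to Y$ with $\|f\|_{\dot C^{0,\omega}(X,Y)}:=\sup_{x\ne y}\frac{\|f(x)-f(y)\|_Y}{\omega(\|x-y\|_X)}<\infty$. For $x\neq y$ put $\mathrm{osc}^\omega_{(x,y)}(f)=\frac{\|f(x)-f(y)\|_Y}{\omega(\|x-y\|_X)}$, and for $\delta>0$ put $\mathrm{osc}^\omega_\delta(f)=\sup\{\mathrm{osc}^\omega_{(x,y)}(f): x,y\in X,\ \|x-y\|_X=\delta\}$. Define $\dot{\mathrm{VC}}^{0,\omega}_{\mathrm{small}}(X,Y)=\{f\in\dot C^{0,\omega}(X,Y):\lim_{\delta\to0}\mathrm{osc}^\omega_\delta(f)=0\}$, $\dot{\mathrm{VC}}^{0,\omega}_{\mathrm{large}}(X,Y)=\{f\in\dot C^{0,\omega}(X,Y):\lim_{\delta\to\infty}\mathrm{osc}^\omega_\delta(f)=0\}$, $\dot{\mathrm{VC}}^{0,\omega}_{\mathrm{far}}(X,Y)=\{f\in\dot C^{0,\omega}(X,Y):\lim_{\delta\to\infty}\sup_{x\ne y,\ \min(\|x\|,\|y\|)>\delta}\mathrm{osc}^\omega_{(x,y)}(f)=0\}$, and $\dot{\mathrm{VC}}^{0,\omega}(X,Y)$ as the intersection of these three sets. For a subset $G$ of $\dot{\mathrm{VC}}^{0,\omega}(\mathbb R^n,Y)$, write $G\subset_u\dot{\mathrm{VC}}^{0,\omega}(\mathbb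 R^n,Y)$ if $\sup_{g\in G}\|g\|_{\dot C^{0,\omega}}<\infty$ and for every $\varepsilon>0$ there is $t>0$ such that, for all $x\ne y$ with $|x-y|<t$ or $|x|>t^{-1}$ or $|y|>t^{-1}$, one has $\sup_{g\in G}\frac{\|g(x)-g(y)\|_Y}{\omega(|x-y|)}<\varepsilon$. For $M>0$, $\tau_M:\mathbb R^n\to B(0,M)$ (closed ball) is defined by $\tau_M(x)=x$ if $|x|<M$; $\tau_M(x)=\left(\frac{2M-|x|}{M}\right)^2x$ if $M\le|x|<2M$; $\tau_M(x)=0$ if $|x|\ge2M$. For $r>0$, $\eta_r\in C^\infty_c(B(0,r))$ is a standard mollifier: a non-negative real-valued smooth bump on $\mathbb R^n$ supported in $B(0,r)$ with $\int_{\mathbb R^n}\eta_r=1$. Convolution: $(g*\eta_r)(x)=\int_{\mathbb R^n}g(x-z)\eta_r(z)\,dz$ (Bochner integral). *)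

theory Defs
  imports "HOL-Analysis.Analysis"
begin

text \<open>
  All suprema are taken in \<^typ>\<open>ennreal\<close>, so an unbounded set has supremum \<open>\<infinity>\<close>.
  A modulus \<open>\<omega>\<close> is a function on \<^typ>\<open>real\<close> of which only the values on \<open>(0,\<infinity>)\<close> are ever used.
\<close>

definition osc :: "(real \<Rightarrow> real) \<Rightarrow> 'a::real_normed_vector \<Rightarrow> 'a \<Rightarrow> ('a \<Rightarrow> 'b::real_normed_vector) \<Rightarrow> ennreal"
  where "osc \<omega> x y f = ennreal (norm (f x - f y) / \<omega> (norm (x - y)))"

definition holder_norm :: "(real \<Rightarrow> real) \<Rightarrow> ('a::real_normed_vector \<Rightarrow> 'b::real_normed_vector) \<Rightarrow> ennreal"
  where "holder_norm \<omega> f = (SUP (x, y) \<in> {(x, y). x \<noteq> y}. osc \<omega> x y f)"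

definition holder_space :: "(real \<Rightarrow> real) \<Rightarrow> ('a::real_normed_vector \<Rightarrow> 'b::real_normed_vector) set"
  where "holder_space \<omega> = {f. holder_norm \<omega> f < \<infinity>}"

definition osc_at :: "(real \<Rightarrow> real) \<Rightarrow> real \<Rightarrow> ('a::real_normed_vector \<Rightarrow> 'b::real_normed_vector) \<Rightarrow> ennreal"
  where "osc_at \<omega> \<delta> f = (SUP (x, y) \<in> {(x, y). norm (x - y) = \<delta>}. osc \<omega> x y f)"

definition osc_far :: "(real \<Rightarrow> real) \<Rightarrow> real \<Rightarrow> ('a::real_normed_vector \<Rightarrow> 'b::real_normed_vector) \<Rightarrow> ennreal"
  where "osc_far \<omega> \<delta> f =
    (SUP (x, y) \<in> {(x, y). x \<noteq> y \<and> min (norm x) (norm y) > \<delta>}. osc \<omega> x y f)"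

definition VC_small :: "(real \<Rightarrow> real) \<Rightarrow> ('a::real_normed_vector \<Rightarrow> 'b::real_normed_vector) set"
  where "VC_small \<omega> = {f \<in> holder_space \<omega>. ((\<lambda>\<delta>. osc_at \<omega> \<delta> f) \<longlongrightarrow> 0) (at_right 0)}"

definition VC_large :: "(real \<Rightarrow> real) \<Rightarrow> ('a::real_normed_vector \<Rightarrow> 'b::real_normed_vector) set"
  where "VC_large \<omega> = {f \<in> holder_space \<omega>. ((\<lambda>\<delta>. osc_at \<omega> \<delta> f) \<longlongrightarrow> 0) at_top}"

definition VC_far :: "(real \<Rightarrow> real) \<Rightarrow> ('a::real_normed_vector \<Rightarrow> 'b::real_normed_vector) set"
  where "VC_far \<omega> = {f \<in> holder_space \<omega>. ((\<lambda>\<delta>. osc_far \<omega> \<delta> f) \<longlongrightarrow> 0) at_top}"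

definition VC :: "(real \<Rightarrow> real) \<Rightarrow> ('a::real_normed_vector \<Rightarrow> 'b::real_normed_vector) set"
  where "VC \<omega> = VC_small \<omega> \<inter> VC_large \<omega> \<inter> VC_far \<omega>"

definition uniformly_VC :: "(real \<Rightarrow> real) \<Rightarrow> ('a::real_normed_vector \<Rightarrow> 'b::real_normed_vector) set \<Rightarrow> bool"
  where "uniformly_VC \<omega> G \<longleftrightarrow>
    G \<subseteq> VC \<omega> \<and>
    (SUP g\<in>G. holder_norm \<omega> g) < \<infinity> \<and>
    (\<forall>\<epsilon>::real. \<epsilon> > 0 \<longrightarrow> (\<exists>t>0. \<forall>x y.
       x \<noteq> y \<and> (norm (x - y) < t \<or> norm x > inverse t \<or> norm y > inverse t) \<longrightarrow>
       (SUP g\<in>G. osc \<omega> x y g) < ennreal \<epsilon>))"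

definition tau :: "real \<Rightarrow> 'a::real_normed_vector \<Rightarrow> 'a"
  where "tau M x =
    (if norm x < M then x
     else if norm x < 2 * M then ((2 * M - norm x) / M)\<^sup>2 *\<^sub>R x
     else 0)"

text \<open>
  \<open>C^k\<close> on the whole (finite-dimensional) space: for \<open>k > 0\<close>, differentiable with all
  directional derivatives of class \<open>C^(k-1)\<close>.
\<close>

primrec C_k :: "nat \<Rightarrow> ('a::euclidean_space \<Rightarrow> 'b::real_normed_vector) \<Rightarrow> bool" where
  "C_k 0 f \<longleftrightarrow> continuous_on UNIV f"
| "C_k (Suc k) f \<longleftrightarrow>
    (\<forall>x. f differentiable (at x)) \<and> (\<forall>v. C_k k (\<lambda>x. frechet_derivative f (at x) v))"

definition smooth :: "('a::euclidean_space \<Rightarrow> 'b::real_normed_vector) \<Rightarrow> bool"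
  where "smooth f \<longleftrightarrow> (\<forall>k. C_k k f)"

definition mollifier :: "real \<Rightarrow> ('a::euclidean_space \<Rightarrow> real) \<Rightarrow> bool"
  where "mollifier r \<eta> \<longleftrightarrow>
    smooth \<eta> \<and> (\<forall>x. \<eta> x \<ge> 0) \<and> closure {x. \<eta> x \<noteq> 0} \<subseteq> cball 0 r \<and>
    integral\<^sup>L lborel \<eta> = 1"

text \<open>
  The library's Bochner integral requires a second-countable codomain, i.e. a separable Banach
  space. The following two definitions are the library's own with that sort constraint dropped.
  For non-separable codomains, the approximating simple functions force \<open>f\<close> to be almost
  everywhere separably valued, so that \<open>f\<close> is strongly measurable as usual.
\<close>

inductive has_banach_integral :: "'a measure \<Rightarrow> ('a \<Rightarrow> 'b) \<Rightarrow> 'b::real_normed_vector \<Rightarrow> bool"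
  for M f I where
  "f \<in> borel_measurable M \<Longrightarrow>
   (\<And>i. Bochner_Integration.simple_bochner_integrable M (s i)) \<Longrightarrow>
   (\<lambda>i. \<integral>\<^sup>+x. norm (f x - s i x) \<partial>M) \<longlonglongrightarrow> 0 \<Longrightarrow>
   (\<lambda>i. Bochner_Integration.simple_bochner_integral M (s i)) \<longlonglongrightarrow> I \<Longrightarrow>
   has_banach_integral M f I"

definition banach_integral :: "'a measure \<Rightarrow> ('a \<Rightarrow> 'b) \<Rightarrow> 'b::banach"
  where "banach_integral M f =
    (if \<exists>I. has_banach_integral M f I then THE I. has_banach_integral M f I else 0)"

lemma has_banach_integral_unique:
  assumes "has_banach_integral M f I" "has_banach_integral M f J"
  shows "I = J"
proof -
  let ?int = "Bochner_Integration.simple_bochner_integral M"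
  obtain s where f: "f \<in> borel_measurable M"
    and s: "\<And>i. Bochner_Integration.simple_bochner_integrable M (s i)"
    and s0: "(\<lambda>i. \<integral>\<^sup>+x. norm (f x - s i x) \<partial>M) \<longlonglongrightarrow> 0"
    and sI: "(\<lambda>i. ?int (s i)) \<longlonglongrightarrow> I"
    using assms(1) by cases blast
  obtain t where t: "\<And>i. Bochner_Integration.simple_bochner_integrable M (t i)"
    and t0: "(\<lambda>i. \<integral>\<^sup>+x. norm (f x - t i x) \<partial>M) \<longlonglongrightarrow> 0"
    and tJ: "(\<lambda>i. ?int (t i)) \<longlonglongrightarrow> J"
    using assms(2) by cases blast
  have meas: "(\<lambda>x. norm (f x - u x)) \<in> borel_measurable M"
    if u: "Bochner_Integration.simple_bochner_integrable M u" for u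
  proof (rule measurable_compose_countable'[where f = "\<lambda>c x. norm (f x - c)" and g = u
        and I = "u ` space M"])
    have sf: "simple_function M u"
      using u by (auto elim: Bochner_Integration.simple_bochner_integrable.cases)
    then show "countable (u ` space M)"
      by (simp add: simple_function_def countable_finite)
    show "u \<in> measurable M (count_space (u ` space M))"
      using sf by (auto simp: simple_function_def measurable_count_space_eq2)
    show "(\<lambda>x. norm (f x - c)) \<in> borel_measurable M" for c
      by (rule measurable_compose[OF f borel_measurable_continuous_onI])
        (intro continuous_intros)
  qed
  have bound: "ennreal (norm (?int (s i) - ?int (t i))) \<le>
      (\<integral>\<^sup>+x. norm (f x - s i x) \<partial>M) + (\<integral>\<^sup>+x. norm (f x - t i x) \<partial>M)" for i
  proof -
    have d: "Bochner_Integration.simple_bochner_integrable M (\<lambda>x. s i x - t i x)"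
      by (rule simple_bochner_integrable_compose2[where p = "(-)", OF _ s t]) simp
    have nd: "Bochner_Integration.simple_bochner_integrable M (\<lambda>x. norm (s i x - t i x))"
      by (rule simple_bochner_integrable_compose2[where p = "\<lambda>x y. norm (x - y)", OF _ s t]) simp
    have "ennreal (norm (?int (s i) - ?int (t i))) = norm (?int (\<lambda>x. s i x - t i x))"
      by (subst simple_bochner_integral_diff[OF s t]) (rule refl)
    also have "\<dots> \<le> Bochner_Integration.simple_bochner_integral M (\<lambda>x. norm (s i x - t i x))"
      by (rule ennreal_leI[OF simple_bochner_integral_norm_bound[OF d]])
    also have "\<dots> = (\<integral>\<^sup>+x. norm (s i x - t i x) \<partial>M)"
      by (rule simple_bochner_integral_eq_nn_integral[OF nd]) simp
    also have "\<dots> \<le> (\<integral>\<^sup>+x. ennreal (norm (f x - s i x)) + ennreal (norm (f x - t i x)) \<partial>M)"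
    proof (intro nn_integral_mono)
      fix x
      have "norm (s i x - t i x) \<le> norm (f x - s i x) + norm (f x - t i x)"
        using norm_triangle_ineq4[of "f x - t i x" "f x - s i x"] by simp
      then show "ennreal (norm (s i x - t i x)) \<le> ennreal (norm (f x - s i x)) + ennreal (norm (f x - t i x))"
        by (simp add: ennreal_leI flip: ennreal_plus)
    qed
    also have "\<dots> = (\<integral>\<^sup>+x. norm (f x - s i x) \<partial>M) + (\<integral>\<^sup>+x. norm (f x - t i x) \<partial>M)"
      by (rule nn_integral_add) (simp_all add: meas s t)
    finally show ?thesis .
  qed
  have "(\<lambda>i. ennreal (norm (?int (s i) - ?int (t i)))) \<longlonglongrightarrow> 0"
  proof (rule tendsto_sandwich[OF _ _ tendsto_const])
    show "(\<lambda>i. (\<integral>\<^sup>+x. norm (f x - s i x) \<partial>M) + (\<integral>\<^sup>+x. norm (f x - t i x) \<partial>M)) \<longlonglongrightarrow> 0"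
      using tendsto_add[OF s0 t0] by simp
  qed (simp_all add: bound)
  then have "(\<lambda>i. norm (?int (s i) - ?int (t i))) \<longlonglongrightarrow> 0"
    by (simp flip: ennreal_0)
  moreover have "(\<lambda>i. norm (?int (s i) - ?int (t i))) \<longlonglongrightarrow> norm (I - J)"
    by (intro tendsto_intros sI tJ)
  ultimately have "norm (I - J) = 0"
    by (rule LIMSEQ_unique[rotated])
  then show ?thesis by simp
qed

lemma has_banach_integral_iff_has_bochner_integral:
  fixes f :: "'a \<Rightarrow> 'b::{banach, second_countable_topology}"
  shows "has_banach_integral M f I \<longleftrightarrow> has_bochner_integral M f I"
  by (simp add: has_banach_integral.simps has_bochner_integral.simps)

lemma banach_integral_eq_lebesgue_integral:
  fixes f :: "'a \<Rightarrow> 'b::{banach, second_countable_topology}"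
  shows "banach_integral M f = integral\<^sup>L M f"
  by (simp add: banach_integral_def lebesgue_integral_def
      has_banach_integral_iff_has_bochner_integral[abs_def])

definition convolution :: "('a::euclidean_space \<Rightarrow> 'b::banach) \<Rightarrow> ('a \<Rightarrow> real) \<Rightarrow> 'a \<Rightarrow> 'b"
  where "convolution g \<eta> x = banach_integral lborel (\<lambda>z. \<eta> z *\<^sub>R g (x - z))"

end

theory Submission
  imports Defs
begin

text \<open>
  The truncation \<open>\<tau>\<^sub>M\<close> is Lipschitz with a constant independent of \<open>M\<close>, so by doubling
  \<open>f \<mapsto> f \<circ> \<tau>\<^sub>M\<close> preserves \<open>\<omega>\<close>-bounds up to a factor \<open>C\<^sub>d\<^sub>b\<^sup>3\<close>; since \<open>\<tau>\<^sub>M\<close> is bounded, the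
  growth of \<open>\<omega>\<close> takes care of distant points. Averaging against a probability density commutes
  with translations and so preserves all bounds. In (3), let \<open>M\<close> be large and consider a pair with
  \<open>x\<close> outside the ball of radius \<open>M\<close> and \<open>\<tau>\<^sub>M x\<close>, \<open>\<tau>\<^sub>M y\<close> in the fixed region where the oscillation of \<open>f\<close>
  is not small. Either \<open>y\<close> lies in that region too, or both points are close to or beyond the sphere of
  radius \<open>2 M\<close>, where the square in the definition of \<open>\<tau>\<^sub>M\<close> makes its Lipschitz constant small; in
  both cases \<open>|x - y|\<close>, and with it \<open>\<omega> |x - y|\<close>, is large. In (4), nearby pairs are controlled by the
  uniform smallness of the oscillation, and the others by \<open>\<omega> (1/K) \<rightarrow> 0\<close>.
\<close>

subsection \<open>Integrals in non-separable Banach spaces\<close>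

text \<open>Borel functions into a non-separable space need not have a Borel difference. Here
  \<open>u\<close> takes finitely many values, so the norm is measurable on each of its level
  sets.\<close>

lemma borel_measurable_norm_diff_simple:
  fixes f u :: "'a \<Rightarrow> 'b::real_normed_vector"
  assumes f: "f \<in> borel_measurable M" and u: "simple_function M u"
  shows "(\<lambda>x. norm (f x - u x)) \<in> borel_measurable M"
proof (rule measurable_compose_countable'[where f = "\<lambda>c x. norm (f x - c)" and g = u
      and I = "u ` space M"])
  show "countable (u ` space M)"
    using u by (simp add: simple_function_def countable_finite)
  show "u \<in> measurable M (count_space (u ` space M))"
    using u by (auto simp: simple_function_def measurable_count_space_eq2)
  show "(\<lambda>x. norm (f x - c)) \<in> borel_measurable M" for c
    by (rule measurable_compose[OF f borel_measurable_continuous_onI])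
      (intro continuous_intros)
qed

lemma simple_bochner_integrable_simple_function:
  "Bochner_Integration.simple_bochner_integrable M u \<Longrightarrow> simple_function M u"
  by (auto elim: Bochner_Integration.simple_bochner_integrable.cases)

lemma norm_simple_bochner_integral_le_nn_integral:
  fixes u :: "'a \<Rightarrow> 'b::real_normed_vector"
  assumes u: "Bochner_Integration.simple_bochner_integrable M u"
  shows "ennreal (norm (Bochner_Integration.simple_bochner_integral M u)) \<le> (\<integral>\<^sup>+x. norm (u x) \<partial>M)"
proof -
  have "Bochner_Integration.simple_bochner_integrable M (\<lambda>x. norm (u x))"
    by (rule simple_bochner_integrable_compose2[where p = "\<lambda>x y. norm x", OF _ u u]) simp
  then show ?thesis
    using simple_bochner_integral_norm_bound[OF u]
    by (simp add: ennreal_leI flip: simple_bochner_integral_eq_nn_integral)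
qed

lemma has_banach_integralE:
  assumes "has_banach_integral M f I"
  obtains s where "f \<in> borel_measurable M"
    "\<And>i. Bochner_Integration.simple_bochner_integrable M (s i)"
    "(\<lambda>i. \<integral>\<^sup>+x. norm (f x - s i x) \<partial>M) \<longlonglongrightarrow> 0"
    "(\<lambda>i. Bochner_Integration.simple_bochner_integral M (s i)) \<longlonglongrightarrow> I"
  using assms by cases blast

text \<open>Splitting the integral of a sum requires measurable summands; distances to simple
  functions are measurable, whence this common shape for the estimates below.\<close>

lemma nn_integral_norm_triangle_simple:
  fixes f g s t :: "'a \<Rightarrow> 'b::real_normed_vector"
  assumes f: "f \<in> borel_measurable M" and g: "g \<in> borel_measurable M"
    and s: "simple_function M s" and t: "simple_function M t"
    and le: "\<And>x. x \<in> space M \<Longrightarrow> h x \<le> norm (f x - s x) + norm (g x - t x)"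
  shows "(\<integral>\<^sup>+x. ennreal (h x) \<partial>M) \<le> (\<integral>\<^sup>+x. norm (f x - s x) \<partial>M) + (\<integral>\<^sup>+x. norm (g x - t x) \<partial>M)"
proof -
  have "(\<integral>\<^sup>+x. ennreal (h x) \<partial>M) \<le> (\<integral>\<^sup>+x. ennreal (norm (f x - s x)) + ennreal (norm (g x - t x)) \<partial>M)"
    by (intro nn_integral_mono) (use le in \<open>auto simp: ennreal_leI simp flip: ennreal_plus\<close>)
  also have "\<dots> = (\<integral>\<^sup>+x. norm (f x - s x) \<partial>M) + (\<integral>\<^sup>+x. norm (g x - t x) \<partial>M)"
    by (rule nn_integral_add)
      (auto intro!: measurable_compose[OF _ measurable_ennreal] borel_measurable_norm_diff_simple f g s t)
  finally show ?thesis .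
qed

text \<open>The triangle inequality bounds the simple integrals by the approximation error plus the
  integral of \<open>norm (f x)\<close>; the error disappears in the limit.\<close>

lemma has_banach_integral_norm_bound:
  assumes "has_banach_integral M f I"
  shows "ennreal (norm I) \<le> (\<integral>\<^sup>+x. norm (f x) \<partial>M)"
proof -
  obtain s where f: "f \<in> borel_measurable M"
    and s: "\<And>i. Bochner_Integration.simple_bochner_integrable M (s i)"
    and s0: "(\<lambda>i. \<integral>\<^sup>+x. norm (f x - s i x) \<partial>M) \<longlonglongrightarrow> 0"
    and sI: "(\<lambda>i. Bochner_Integration.simple_bochner_integral M (s i)) \<longlonglongrightarrow> I"
    using has_banach_integralE[OF assms] by blast
  have lim: "(\<lambda>i. ennreal (norm (Bochner_Integration.simple_bochner_integral M (s i)))) \<longlonglongrightarrow> ennreal (norm I)"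
    by (intro tendsto_ennrealI tendsto_norm sI)
  have lim': "(\<lambda>i. (\<integral>\<^sup>+x. norm (f x - s i x) \<partial>M) + (\<integral>\<^sup>+x. norm (f x) \<partial>M)) \<longlonglongrightarrow>
      (\<integral>\<^sup>+x. norm (f x) \<partial>M)"
    using tendsto_add[OF s0 tendsto_const] by simp
  have le: "ennreal (norm (Bochner_Integration.simple_bochner_integral M (s i))) \<le>
      (\<integral>\<^sup>+x. norm (f x - s i x) \<partial>M) + (\<integral>\<^sup>+x. norm (f x) \<partial>M)" for i
  proof -
    have "(\<integral>\<^sup>+x. ennreal (norm (s i x)) \<partial>M) \<le>
        (\<integral>\<^sup>+x. norm (f x - s i x) \<partial>M) + (\<integral>\<^sup>+x. norm (f x - 0) \<partial>M)"
      by (rule nn_integral_norm_triangle_simple)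
        (auto intro!: f s simple_bochner_integrable_simple_function
          intro: order.trans[OF norm_triangle_sub] simp: norm_minus_commute add.commute)
    then show ?thesis
      using norm_simple_bochner_integral_le_nn_integral[OF s[of i]] by simp
  qed
  show ?thesis
    by (rule LIMSEQ_le[OF lim lim']) (use le in auto)
qed

text \<open>Measurability of the difference is a hypothesis because it can fail for Borel functions
  with non-separable values; the integrands to which this is applied are continuous.\<close>

lemma has_banach_integral_diff:
  assumes "has_banach_integral M f I" "has_banach_integral M g J"
    and meas: "(\<lambda>x. f x - g x) \<in> borel_measurable M"
  shows "has_banach_integral M (\<lambda>x. f x - g x) (I - J)"
proof -
  obtain s where f: "f \<in> borel_measurable M"
    and s: "\<And>i. Bochner_Integration.simple_bochner_integrable M (s i)"
    and s0: "(\<lambda>i. \<integral>\<^sup>+x. norm (f x - s i x) \<partial>M) \<longlonglongrightarrow> 0"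
    and sI: "(\<lambda>i. Bochner_Integration.simple_bochner_integral M (s i)) \<longlonglongrightarrow> I"
    using has_banach_integralE[OF assms(1)] by blast
  obtain t where g: "g \<in> borel_measurable M"
    and t: "\<And>i. Bochner_Integration.simple_bochner_integrable M (t i)"
    and t0: "(\<lambda>i. \<integral>\<^sup>+x. norm (g x - t i x) \<partial>M) \<longlonglongrightarrow> 0"
    and tJ: "(\<lambda>i. Bochner_Integration.simple_bochner_integral M (t i)) \<longlonglongrightarrow> J"
    using has_banach_integralE[OF assms(2)] by blast
  show ?thesis
  proof (rule has_banach_integral.intros[OF meas, where s = "\<lambda>i x. s i x - t i x"])
    show "Bochner_Integration.simple_bochner_integrable M (\<lambda>x. s i x - t i x)" for i
      by (rule simple_bochner_integrable_compose2[where p = "(-)", OF _ s t]) simp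
    show "(\<lambda>i. Bochner_Integration.simple_bochner_integral M (\<lambda>x. s i x - t i x)) \<longlonglongrightarrow> I - J"
      by (subst simple_bochner_integral_diff[OF s t]) (intro tendsto_diff sI tJ)
    show "(\<lambda>i. \<integral>\<^sup>+x. norm (f x - g x - (s i x - t i x)) \<partial>M) \<longlonglongrightarrow> 0"
    proof (rule tendsto_sandwich[OF _ _ tendsto_const])
      show "(\<lambda>i. (\<integral>\<^sup>+x. norm (f x - s i x) \<partial>M) + (\<integral>\<^sup>+x. norm (g x - t i x) \<partial>M)) \<longlonglongrightarrow> 0"
        using tendsto_add[OF s0 t0] by simp
      have "(\<integral>\<^sup>+x. ennreal (norm (f x - g x - (s i x - t i x))) \<partial>M) \<le>
          (\<integral>\<^sup>+x. norm (f x - s i x) \<partial>M) + (\<integral>\<^sup>+x. norm (g x - t i x) \<partial>M)" for i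
      proof (rule nn_integral_norm_triangle_simple)
        show "norm (f x - g x - (s i x - t i x)) \<le> norm (f x - s i x) + norm (g x - t i x)" for x
          using norm_triangle_ineq4[of "f x - s i x" "g x - t i x"] by (simp add: algebra_simps)
      qed (intro f g s t simple_bochner_integrable_simple_function)+
      then show "\<forall>\<^sub>F i in sequentially. (\<integral>\<^sup>+x. norm (f x - g x - (s i x - t i x)) \<partial>M) \<le>
          (\<integral>\<^sup>+x. norm (f x - s i x) \<partial>M) + (\<integral>\<^sup>+x. norm (g x - t i x) \<partial>M)"
        by simp
    qed simp
  qed
qed

text \<open>Scaling scalar simple approximants by \<open>c\<close> gives vector-valued ones. This
  evaluates the average of a constant, which is how \<open>g x\<close> itself becomes an
  integral.\<close>

lemma has_banach_integral_scaleR_left: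
  fixes \<phi> :: "'a \<Rightarrow> real" and c :: "'b::real_normed_vector"
  assumes "has_bochner_integral M \<phi> a"
  shows "has_banach_integral M (\<lambda>x. \<phi> x *\<^sub>R c) (a *\<^sub>R c)"
proof -
  obtain s where \<phi>: "\<phi> \<in> borel_measurable M"
    and s: "\<And>i. Bochner_Integration.simple_bochner_integrable M (s i)"
    and s0: "(\<lambda>i. \<integral>\<^sup>+x. norm (\<phi> x - s i x) \<partial>M) \<longlonglongrightarrow> 0"
    and sI: "(\<lambda>i. Bochner_Integration.simple_bochner_integral M (s i)) \<longlonglongrightarrow> a"
    using assms by cases blast
  have lin: "linear (\<lambda>r::real. r *\<^sub>R c)"
    by (intro bounded_linear.linear bounded_linear_scaleR_left)
  show ?thesis
  proof (rule has_banach_integral.intros[where s = "\<lambda>i x. s i x *\<^sub>R c"])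
    show "(\<lambda>x. \<phi> x *\<^sub>R c) \<in> borel_measurable M"
      by (rule measurable_compose[OF \<phi> borel_measurable_continuous_onI]) (intro continuous_intros)
    show "Bochner_Integration.simple_bochner_integrable M (\<lambda>x. s i x *\<^sub>R c)" for i
      by (rule simple_bochner_integrable_compose2[where p = "\<lambda>x y. x *\<^sub>R c", OF _ s s]) simp
    show "(\<lambda>i. Bochner_Integration.simple_bochner_integral M (\<lambda>x. s i x *\<^sub>R c)) \<longlonglongrightarrow> a *\<^sub>R c"
      by (subst simple_bochner_integral_linear[OF lin s]) (intro tendsto_intros sI)
    have "(\<integral>\<^sup>+x. norm (\<phi> x *\<^sub>R c - s i x *\<^sub>R c) \<partial>M) = (\<integral>\<^sup>+x. norm (\<phi> x - s i x) \<partial>M) * ennreal (norm c)" for i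
    proof -
      have "(\<integral>\<^sup>+x. norm (\<phi> x *\<^sub>R c - s i x *\<^sub>R c) \<partial>M) =
          (\<integral>\<^sup>+x. ennreal (norm (\<phi> x - s i x)) * ennreal (norm c) \<partial>M)"
        by (simp add: ennreal_mult flip: scaleR_diff_left)
      also have "\<dots> = (\<integral>\<^sup>+x. norm (\<phi> x - s i x) \<partial>M) * ennreal (norm c)"
        by (rule nn_integral_multc)
          (intro measurable_compose[OF _ measurable_ennreal] borel_measurable_norm_diff_simple \<phi> s
            simple_bochner_integrable_simple_function)
      finally show ?thesis .
    qed
    then show "(\<lambda>i. \<integral>\<^sup>+x. norm (\<phi> x *\<^sub>R c - s i x *\<^sub>R c) \<partial>M) \<longlonglongrightarrow> 0"
      using tendsto_mult_ennreal[OF s0 tendsto_const, of "ennreal (norm c)"] by simp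
  qed
qed

text \<open>The integrals of the \<open>s i\<close> differ by at most the sum of two approximation
  errors, so they form a Cauchy sequence, and completeness provides the limit.\<close>

lemma has_banach_integral_of_simple_approx:
  fixes f :: "'a \<Rightarrow> 'b::banach"
  assumes f: "f \<in> borel_measurable M"
    and s: "\<And>i. Bochner_Integration.simple_bochner_integrable M (s i)"
    and s0: "(\<lambda>i. \<integral>\<^sup>+x. norm (f x - s i x) \<partial>M) \<longlonglongrightarrow> 0"
  shows "\<exists>I. has_banach_integral M f I"
proof -
  let ?int = "\<lambda>i. Bochner_Integration.simple_bochner_integral M (s i)"
  let ?e = "\<lambda>i. \<integral>\<^sup>+x. norm (f x - s i x) \<partial>M"
  have le: "ennreal (norm (?int i - ?int j)) \<le> ?e i + ?e j" for i j
  proof -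
    have d: "Bochner_Integration.simple_bochner_integrable M (\<lambda>x. s i x - s j x)"
      by (rule simple_bochner_integrable_compose2[where p = "(-)", OF _ s s]) simp
    have "ennreal (norm (?int i - ?int j)) \<le> (\<integral>\<^sup>+x. norm (s i x - s j x) \<partial>M)"
      using norm_simple_bochner_integral_le_nn_integral[OF d]
      by (simp add: simple_bochner_integral_diff s)
    also have "\<dots> \<le> ?e i + ?e j"
    proof (rule nn_integral_norm_triangle_simple)
      show "norm (s i x - s j x) \<le> norm (f x - s i x) + norm (f x - s j x)" for x
        using norm_triangle_ineq4[of "f x - s j x" "f x - s i x"] by simp
    qed (intro f s simple_bochner_integrable_simple_function)+
    finally show ?thesis .
  qed
  have "Cauchy ?int"
  proof (rule CauchyI)
    fix e :: real assume e: "0 < e"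
    then have "\<forall>\<^sub>F i in sequentially. ?e i < ennreal (e / 2)"
      by (intro order_tendstoD(2)[OF s0]) simp
    then obtain N where N: "\<And>i. i \<ge> N \<Longrightarrow> ?e i < ennreal (e / 2)"
      by (auto simp: eventually_sequentially)
    have "norm (?int i - ?int j) < e" if "i \<ge> N" "j \<ge> N" for i j
    proof -
      have "ennreal (norm (?int i - ?int j)) < ennreal (e / 2) + ennreal (e / 2)"
        using le[of i j] N[OF that(1)] N[OF that(2)] by (meson add_strict_mono le_less_trans)
      also have "\<dots> = ennreal e"
        using e by (simp flip: ennreal_plus)
      finally show ?thesis by (simp add: ennreal_less_iff)
    qed
    then show "\<exists>N. \<forall>m\<ge>N. \<forall>n\<ge>N. norm (?int m - ?int n) < e" by blast
  qed
  then obtain I where "?int \<longlonglongrightarrow> I"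
    by (auto simp: Cauchy_convergent_iff convergent_def)
  then show ?thesis
    using has_banach_integral.intros[OF f s s0] by blast
qed

text \<open>
  Simple functions approximating the identity exist because the domain is separable; composing
  \<open>f\<close> with them avoids any separability of the codomain.
\<close>

lemma has_banach_integral_continuous_compact_support:
  fixes f :: "'a::euclidean_space \<Rightarrow> 'b::banach"
  assumes cont: "continuous_on UNIV f" and supp: "\<And>x. r < norm x \<Longrightarrow> f x = 0"
  shows "\<exists>I. has_banach_integral lborel f I"
proof -
  obtain F :: "nat \<Rightarrow> 'a \<Rightarrow> 'a" where F: "\<And>i. simple_function lborel (F i)"
    and Flim: "\<And>x. (\<lambda>i. F i x) \<longlonglongrightarrow> x" and Fle: "\<And>i x. norm (F i x) \<le> 2 * norm x"
    using borel_measurable_implies_sequence_metric[of "\<lambda>x::'a. x" lborel 0]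
    by (auto simp: space_borel)
  \<comment> \<open>The indicator confines the approximants to a set of finite measure and changes
    nothing in the limit, since \<open>f\<close> vanishes outside the ball.\<close>
  define s where "s i x = indicator (cball 0 r) x *\<^sub>R f (F i x)" for i x
  have f: "f \<in> borel_measurable lborel"
    using borel_measurable_continuous_onI[OF cont] by simp
  have s: "simple_function lborel (s i)" for i
    unfolding s_def
    by (rule simple_function_compose2[where h = "\<lambda>a y. a *\<^sub>R f y"]) (auto intro: F)
  \<comment> \<open>The radius is doubled because
    \<open>norm (F i x) \<le> 2 * norm x\<close>.\<close>
  have "compact (f ` cball 0 (2 * r))"
    using cont by (intro compact_continuous_image continuous_on_subset[OF cont]) auto
  then obtain B where B: "\<And>x. norm x \<le> 2 * r \<Longrightarrow> norm (f x) \<le> B"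
    by (force dest!: compact_imp_bounded simp: bounded_iff)
  \<comment> \<open>For negative \<open>r\<close> the ball is empty and \<open>B\<close> may be
    negative; the maximum secures a nonnegative bound.\<close>
  define B' where "B' = max B 0"
  have B': "norm x \<le> 2 * r \<Longrightarrow> norm (f x) \<le> B'" "0 \<le> B'" for x
    using B[of x] by (auto simp: B'_def)
  have sB: "norm (s i x) \<le> B' * indicator (cball 0 r) x" for i x
  proof (cases "x \<in> cball 0 r")
    case True
    then show ?thesis
      using Fle[of i x] by (auto simp: s_def intro!: B')
  qed (simp add: s_def)
  have fB: "norm (f x) \<le> B' * indicator (cball 0 r) x" for x
  proof (cases "x \<in> cball 0 r")
    case True
    then have "norm x \<le> 2 * r" using norm_ge_zero[of x] unfolding mem_cball_0 by linarith
    then show ?thesis using True by (auto intro!: B')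
  qed (use supp[of x] in auto)
  have fin: "(\<integral>\<^sup>+x. ennreal (c * indicator (cball (0::'a) r) x) \<partial>lborel) < \<infinity>" if "0 \<le> c" for c
  proof -
    have "(\<integral>\<^sup>+x. ennreal (c * indicator (cball (0::'a) r) x) \<partial>lborel) =
        (\<integral>\<^sup>+x. ennreal c * indicator (cball (0::'a) r) x \<partial>lborel)"
      by (intro nn_integral_cong) (auto split: split_indicator)
    also have "\<dots> = ennreal c * emeasure lborel (cball (0::'a) r)"
      by (rule nn_integral_cmult_indicator) simp
    also have "\<dots> < \<infinity>"
      using emeasure_bounded_finite[of "cball (0::'a) r"]
      by (auto simp: ennreal_mult_less_top)
    finally show ?thesis .
  qed
  show ?thesis
  proof (rule has_banach_integral_of_simple_approx[OF f])
    show "Bochner_Integration.simple_bochner_integrable lborel (s i)" for i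
    proof (rule simple_bochner_integrableI_bounded[OF s])
      have "(\<integral>\<^sup>+x. norm (s i x) \<partial>lborel) \<le> (\<integral>\<^sup>+x. ennreal (B' * indicator (cball (0::'a) r) x) \<partial>lborel)"
        by (intro nn_integral_mono ennreal_leI sB)
      then show "(\<integral>\<^sup>+x. norm (s i x) \<partial>lborel) < \<infinity>"
        using fin[OF B'(2)] by (rule le_less_trans)
    qed
    have "(\<lambda>i. \<integral>\<^sup>+x. ennreal (norm (f x - s i x)) \<partial>lborel) \<longlonglongrightarrow> (\<integral>\<^sup>+(x::'a). 0 \<partial>lborel)"
    proof (rule nn_integral_dominated_convergence
        [where w = "\<lambda>x. ennreal ((2 * B') * indicator (cball (0::'a) r) x)"])
      show "(\<lambda>x. ennreal (norm (f x - s i x))) \<in> borel_measurable lborel" for i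
        by (intro measurable_compose[OF _ measurable_ennreal] borel_measurable_norm_diff_simple f s)
      show "(\<lambda>x. ennreal ((2 * B') * indicator (cball (0::'a) r) x)) \<in> borel_measurable lborel"
        by (auto intro!: measurable_compose[OF _ measurable_ennreal] borel_measurable_times
            borel_measurable_indicator)
      show "(\<integral>\<^sup>+x. ennreal ((2 * B') * indicator (cball (0::'a) r) x) \<partial>lborel) < \<infinity>"
        using B'(2) by (intro fin) simp
      have "norm (f x - s i x) \<le> 2 * B' * indicator (cball 0 r) x" for i x
        using norm_triangle_ineq4[of "f x" "s i x"] sB[of i x] fB[of x] by linarith
      then show "AE x in lborel. ennreal (norm (f x - s i x)) \<le> ennreal ((2 * B') * indicator (cball (0::'a) r) x)" for i
        by (auto intro!: ennreal_leI)
      have "(\<lambda>i. ennreal (norm (f x - s i x))) \<longlonglongrightarrow> 0" for x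
      proof -
        have "isCont f x"
          using cont by (simp add: continuous_on_eq_continuous_at)
        then have "(\<lambda>i. s i x) \<longlonglongrightarrow> indicator (cball 0 r) x *\<^sub>R f x"
          unfolding s_def by (intro tendsto_intros isCont_tendsto_compose[OF _ Flim])
        also have "indicator (cball 0 r) x *\<^sub>R f x = f x"
          using supp[of x] by (auto split: split_indicator)
        finally have "(\<lambda>i. norm (f x - s i x)) \<longlonglongrightarrow> norm (f x - f x)"
          by (intro tendsto_intros)
        then show ?thesis
          by (metis diff_self norm_zero tendsto_ennrealI ennreal_0)
      qed
      then show "AE x in lborel. (\<lambda>i. ennreal (norm (f x - s i x))) \<longlonglongrightarrow> 0"
        by simp
    qed simp_all
    then show "(\<lambda>i. \<integral>\<^sup>+x. norm (f x - s i x) \<partial>lborel) \<longlonglongrightarrow> 0"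
      by simp
  qed
qed

lemma has_banach_integral_banach_integral:
  assumes "has_banach_integral M f I"
  shows "has_banach_integral M f (banach_integral M f)"
proof -
  have "(THE I. has_banach_integral M f I) = I"
    using assms has_banach_integral_unique by blast
  then show ?thesis
    using assms by (auto simp: banach_integral_def)
qed

subsection \<open>Averages against a mollifier\<close>

lemma mollifierD:
  assumes "mollifier r \<eta>"
  shows mollifier_continuous: "continuous_on UNIV \<eta>"
    and mollifier_nonneg: "0 \<le> \<eta> z"
    and mollifier_eq_0: "r < norm z \<Longrightarrow> \<eta> z = 0"
    and has_bochner_integral_mollifier: "has_bochner_integral lborel \<eta> 1"
proof -
  have "C_k 0 \<eta>"
    using assms by (auto simp: mollifier_def smooth_def)
  then show "continuous_on UNIV \<eta>" by simp
  show "0 \<le> \<eta> z"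
    using assms by (simp add: mollifier_def)
  have "{x. \<eta> x \<noteq> 0} \<subseteq> cball 0 r"
    using assms closure_subset[of "{x. \<eta> x \<noteq> 0}"] unfolding mollifier_def by blast
  then show "r < norm z \<Longrightarrow> \<eta> z = 0" by (auto simp: subset_iff)
  have "integral\<^sup>L lborel \<eta> = 1"
    using assms by (simp add: mollifier_def)
  \<comment> \<open>The library integral is \<open>0\<close> for non-integrable functions, so the
    value \<open>1\<close> forces integrability.\<close>
  then show "has_bochner_integral lborel \<eta> 1"
    by (metis has_bochner_integral_integrable not_integrable_integral_eq zero_neq_one)
qed

text \<open>The integrand is continuous with compact support, hence integrable, so
  \<open>convolution\<close> is a genuine integral and not the default value
  \<open>0\<close>.\<close>

lemma has_banach_integral_convolution:
  fixes g :: "'a::euclidean_space \<Rightarrow> 'b::banach"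
  assumes \<eta>: "mollifier r \<eta>" and g: "continuous_on UNIV g"
  shows "has_banach_integral lborel (\<lambda>z. \<eta> z *\<^sub>R g (x - z)) (convolution g \<eta> x)"
proof -
  have "continuous_on UNIV (\<lambda>z. \<eta> z *\<^sub>R g (x - z))"
    by (intro continuous_intros mollifier_continuous[OF \<eta>] continuous_on_compose2[OF g]) auto
  then obtain I where "has_banach_integral lborel (\<lambda>z. \<eta> z *\<^sub>R g (x - z)) I"
    using has_banach_integral_continuous_compact_support[of "\<lambda>z. \<eta> z *\<^sub>R g (x - z)" r]
      mollifier_eq_0[OF \<eta>] by auto
  then show ?thesis
    unfolding convolution_def by (rule has_banach_integral_banach_integral)
qed

text \<open>\<open>\<eta>\<close> is a probability density on the ball of radius \<open>r\<close>,
  so the average obeys any bound valid for \<open>u\<close> on that ball.\<close>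

lemma norm_mollifier_average_le:
  fixes u :: "'a::euclidean_space \<Rightarrow> 'b::banach"
  assumes \<eta>: "mollifier r \<eta>" and I: "has_banach_integral lborel (\<lambda>z. \<eta> z *\<^sub>R u z) I"
    and u: "\<And>z. norm z \<le> r \<Longrightarrow> norm (u z) \<le> B" and B: "0 \<le> B"
  shows "norm I \<le> B"
proof -
  have "ennreal (norm I) \<le> (\<integral>\<^sup>+z. ennreal (norm (\<eta> z *\<^sub>R u z)) \<partial>lborel)"
    by (rule has_banach_integral_norm_bound[OF I])
  also have "\<dots> \<le> (\<integral>\<^sup>+z. ennreal (\<eta> z * B) \<partial>lborel)"
  proof (intro nn_integral_mono ennreal_leI)
    fix z show "norm (\<eta> z *\<^sub>R u z) \<le> \<eta> z * B"
      using u[of z] mollifier_eq_0[OF \<eta>, of z] mollifier_nonneg[OF \<eta>, of z]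
      by (cases "norm z \<le> r") (auto intro!: mult_left_mono)
  qed
  also have "\<dots> = ennreal B"
    using has_bochner_integral_mult_left[OF has_bochner_integral_mollifier[OF \<eta>], of B] B
      mollifier_nonneg[OF \<eta>]
    by (subst nn_integral_eq_integral) (auto simp: has_bochner_integral_iff)
  finally show ?thesis
    using B by simp
qed

text \<open>By linearity the difference is the average of \<open>g (x - z) - g (y - z)\<close>,
  taken over pairs with the same separation as \<open>x\<close> and \<open>y\<close>.\<close>

lemma norm_convolution_diff_le:
  fixes g :: "'a::euclidean_space \<Rightarrow> 'b::banach"
  assumes \<eta>: "mollifier r \<eta>" and g: "continuous_on UNIV g"
    and le: "\<And>z. norm z \<le> r \<Longrightarrow> norm (g (x - z) - g (y - z)) \<le> B" and B: "0 \<le> B"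
  shows "norm (convolution g \<eta> x - convolution g \<eta> y) \<le> B"
proof (rule norm_mollifier_average_le[OF \<eta> _ le B])
  have cont: "continuous_on UNIV (\<lambda>z. g (w - z))" for w
    by (rule continuous_on_compose2[OF g]) (auto intro!: continuous_intros)
  show "has_banach_integral lborel (\<lambda>z. \<eta> z *\<^sub>R (g (x - z) - g (y - z)))
      (convolution g \<eta> x - convolution g \<eta> y)"
    unfolding scaleR_diff_right
  proof (rule has_banach_integral_diff)
    show "(\<lambda>z. \<eta> z *\<^sub>R g (x - z) - \<eta> z *\<^sub>R g (y - z)) \<in> borel_measurable lborel"
      using mollifier_continuous[OF \<eta>]
      by (simp, intro borel_measurable_continuous_onI continuous_intros cont)
  qed (rule has_banach_integral_convolution[OF \<eta> g])+
qed

text \<open>Since \<open>\<eta>\<close> has mass one, \<open>g x\<close> is the average of a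
  constant, and the error is the average of \<open>g x - g (x - z)\<close>.\<close>

lemma norm_diff_convolution_le:
  fixes g :: "'a::euclidean_space \<Rightarrow> 'b::banach"
  assumes \<eta>: "mollifier r \<eta>" and g: "continuous_on UNIV g"
    and le: "\<And>z. norm z \<le> r \<Longrightarrow> norm (g x - g (x - z)) \<le> B" and B: "0 \<le> B"
  shows "norm (g x - convolution g \<eta> x) \<le> B"
proof (rule norm_mollifier_average_le[OF \<eta> _ le B])
  have cont: "continuous_on UNIV (\<lambda>z. g (x - z))"
    by (rule continuous_on_compose2[OF g]) (auto intro!: continuous_intros)
  show "has_banach_integral lborel (\<lambda>z. \<eta> z *\<^sub>R (g x - g (x - z))) (g x - convolution g \<eta> x)"
    unfolding scaleR_diff_right
  proof (rule has_banach_integral_diff)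
    show "has_banach_integral lborel (\<lambda>z. \<eta> z *\<^sub>R g x) (g x)"
      using has_banach_integral_scaleR_left[OF has_bochner_integral_mollifier[OF \<eta>], of "g x"] by simp
    show "(\<lambda>z. \<eta> z *\<^sub>R g x - \<eta> z *\<^sub>R g (x - z)) \<in> borel_measurable lborel"
      using mollifier_continuous[OF \<eta>]
      by (simp, intro borel_measurable_continuous_onI continuous_intros cont)
  qed (rule has_banach_integral_convolution[OF \<eta> g])
qed

subsection \<open>Uniformly vanishing oscillation\<close>

lemma osc_le_ennreal_iff:
  assumes "0 < \<omega> (norm (x - y))" "0 \<le> e"
  shows "osc \<omega> x y f \<le> ennreal e \<longleftrightarrow> norm (f x - f y) \<le> e * \<omega> (norm (x - y))"
  using assms by (simp add: osc_def pos_divide_le_eq)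

lemma holder_norm_le_iff:
  fixes f :: "'a::real_normed_vector \<Rightarrow> 'b::real_normed_vector"
  assumes "\<And>t. 0 < t \<Longrightarrow> 0 < \<omega> t" "0 \<le> C"
  shows "holder_norm \<omega> f \<le> ennreal C \<longleftrightarrow> (\<forall>x y. x \<noteq> y \<longrightarrow> norm (f x - f y) \<le> C * \<omega> (norm (x - y)))"
proof -
  have "osc \<omega> x y f \<le> ennreal C \<longleftrightarrow> norm (f x - f y) \<le> C * \<omega> (norm (x - y))" if "x \<noteq> y" for x y
    using assms that by (intro osc_le_ennreal_iff) auto
  then show ?thesis
    unfolding holder_norm_def SUP_le_iff by auto
qed

lemma tendsto_0_ennrealI:
  fixes f :: "'a \<Rightarrow> ennreal"
  assumes "\<And>e::real. 0 < e \<Longrightarrow> \<forall>\<^sub>F x in F. f x \<le> ennreal e"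
  shows "(f \<longlongrightarrow> 0) F"
proof (rule order_tendstoI)
  fix a :: ennreal assume "0 < a"
  then obtain b where "0 < b" "b < a" using dense by blast
  then obtain e where "b = ennreal e" "0 < e"
    by (cases b) (auto simp: top.extremum_strict)
  then show "\<forall>\<^sub>F x in F. f x < a"
    using assms[of e] \<open>b < a\<close> by (auto elim!: eventually_mono)
qed simp

text \<open>The range of pairs in the vanishing condition of \<open>uniformly_VC\<close>, named so
  that it can be tracked under truncation and translation.\<close>

definition close_or_far :: "real \<Rightarrow> 'a::real_normed_vector \<Rightarrow> 'a \<Rightarrow> bool"
  where "close_or_far t x y \<longleftrightarrow>
    x \<noteq> y \<and> (norm (x - y) < t \<or> norm x > inverse t \<or> norm y > inverse t)"

text \<open>One condition yields all three limits: separation below \<open>t\<close> is the small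
  scale, separation above \<open>2 * inverse t\<close> forces one point beyond
  \<open>inverse t\<close>, and the far condition puts both points there.\<close>

lemma mem_VC_I:
  fixes f :: "'a::real_normed_vector \<Rightarrow> 'b::real_normed_vector"
  assumes \<omega>: "\<And>t. 0 < t \<Longrightarrow> 0 < \<omega> t"
    and C: "0 \<le> C" "\<And>x y. x \<noteq> y \<Longrightarrow> norm (f x - f y) \<le> C * \<omega> (norm (x - y))"
    and van: "\<And>\<epsilon>. 0 < \<epsilon> \<Longrightarrow>
      \<exists>t>0. \<forall>x y. close_or_far t x y \<longrightarrow> norm (f x - f y) \<le> \<epsilon> * \<omega> (norm (x - y))"
  shows "f \<in> VC \<omega>"
proof -
  have "holder_norm \<omega> f \<le> ennreal C"
    using C by (simp add: holder_norm_le_iff[of \<omega>, OF \<omega>])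
  then have "f \<in> holder_space \<omega>"
    by (auto simp: holder_space_def intro: le_less_trans)
  have ex: "\<exists>t>0. \<forall>x y. close_or_far t x y \<longrightarrow> osc \<omega> x y f \<le> ennreal e" if e: "0 < e" for e
  proof -
    obtain t where t: "0 < t"
      "\<And>x y. close_or_far t x y \<Longrightarrow> norm (f x - f y) \<le> e * \<omega> (norm (x - y))"
      using van[OF e] by blast
    have "osc \<omega> x y f \<le> ennreal e" if xy: "close_or_far t x y" for x y
      using e t(2)[OF xy] xy
      by (subst osc_le_ennreal_iff) (auto simp: close_or_far_def intro!: \<omega>)
    then show ?thesis using t(1) by blast
  qed
  have small: "((\<lambda>\<delta>. osc_at \<omega> \<delta> f) \<longlongrightarrow> 0) (at_right 0)"
  proof (rule tendsto_0_ennrealI)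
    fix e :: real assume "0 < e"
    then obtain t where t: "0 < t" "\<And>x y. close_or_far t x y \<Longrightarrow> osc \<omega> x y f \<le> ennreal e"
      using ex[OF \<open>0 < e\<close>] by blast
    have "osc_at \<omega> \<delta> f \<le> ennreal e" if "0 < \<delta>" "\<delta> < t" for \<delta>
      unfolding osc_at_def using that by (auto intro!: SUP_least t(2) simp: close_or_far_def)
    then show "\<forall>\<^sub>F \<delta> in at_right 0. osc_at \<omega> \<delta> f \<le> ennreal e"
      using t(1) by (auto simp: eventually_at_right_field)
  qed
  have large: "((\<lambda>\<delta>. osc_at \<omega> \<delta> f) \<longlongrightarrow> 0) at_top"
  proof (rule tendsto_0_ennrealI)
    fix e :: real assume "0 < e"
    then obtain t where t: "0 < t" "\<And>x y. close_or_far t x y \<Longrightarrow> osc \<omega> x y f \<le> ennreal e"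
      using ex[OF \<open>0 < e\<close>] by blast
    have "osc_at \<omega> \<delta> f \<le> ennreal e" if "2 * inverse t < \<delta>" for \<delta>
      unfolding osc_at_def
    proof (safe intro!: SUP_least)
      fix x y :: 'a assume \<delta>: "\<delta> = norm (x - y)"
      have "norm x > inverse t \<or> norm y > inverse t"
        using norm_triangle_ineq4[of x y] that \<delta> by linarith
      moreover have "x \<noteq> y"
      proof
        assume "x = y"
        with that \<delta> have "inverse t < 0" by simp
        with t(1) show False by simp
      qed
      ultimately show "osc \<omega> x y f \<le> ennreal e"
        by (intro t(2)) (simp add: close_or_far_def)
    qed
    then show "\<forall>\<^sub>F \<delta> in at_top. osc_at \<omega> \<delta> f \<le> ennreal e"
      by (auto intro: eventually_mono[OF eventually_gt_at_top[of "2 * inverse t"]])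
  qed
  have far: "((\<lambda>\<delta>. osc_far \<omega> \<delta> f) \<longlongrightarrow> 0) at_top"
  proof (rule tendsto_0_ennrealI)
    fix e :: real assume "0 < e"
    then obtain t where t: "0 < t" "\<And>x y. close_or_far t x y \<Longrightarrow> osc \<omega> x y f \<le> ennreal e"
      using ex[OF \<open>0 < e\<close>] by blast
    have "osc_far \<omega> \<delta> f \<le> ennreal e" if "inverse t < \<delta>" for \<delta>
      using that by (auto simp: osc_far_def close_or_far_def intro!: SUP_least t(2))
    then show "\<forall>\<^sub>F \<delta> in at_top. osc_far \<omega> \<delta> f \<le> ennreal e"
      by (auto intro: eventually_mono[OF eventually_gt_at_top[of "inverse t"]])
  qed
  show ?thesis
    using \<open>f \<in> holder_space \<omega>\<close> small large far
    by (simp add: VC_def VC_small_def VC_large_def VC_far_def)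
qed

lemma uniformly_VC_I:
  fixes G :: "('a::real_normed_vector \<Rightarrow> 'b::real_normed_vector) set"
  assumes \<omega>: "\<And>t. 0 < t \<Longrightarrow> 0 < \<omega> t"
    and C: "0 \<le> C" "\<And>g x y. g \<in> G \<Longrightarrow> x \<noteq> y \<Longrightarrow> norm (g x - g y) \<le> C * \<omega> (norm (x - y))"
    and van: "\<And>\<epsilon>. 0 < \<epsilon> \<Longrightarrow> \<exists>t>0. \<forall>g\<in>G. \<forall>x y. close_or_far t x y \<longrightarrow>
      norm (g x - g y) \<le> \<epsilon> * \<omega> (norm (x - y))"
  shows "uniformly_VC \<omega> G"
proof -
  have "g \<in> VC \<omega>" if g: "g \<in> G" for g
  proof (rule mem_VC_I[where C = C])
    show "0 < \<omega> t" if "0 < t" for t by (rule \<omega>[OF that])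
    show "0 \<le> C" by (rule C(1))
    show "norm (g x - g y) \<le> C * \<omega> (norm (x - y))" if "x \<noteq> y" for x y
      by (rule C(2)[OF g that])
    show "\<exists>t>0. \<forall>x y. close_or_far t x y \<longrightarrow> norm (g x - g y) \<le> \<epsilon> * \<omega> (norm (x - y))"
      if "0 < \<epsilon>" for \<epsilon>
      using van[OF that] g by blast
  qed
  moreover have "(SUP g\<in>G. holder_norm \<omega> g) < \<infinity>"
  proof -
    have "(SUP g\<in>G. holder_norm \<omega> g) \<le> ennreal C"
      using C by (intro SUP_least) (simp add: holder_norm_le_iff[of \<omega>, OF \<omega>])
    also have "\<dots> < \<infinity>" by simp
    finally show ?thesis .
  qed
  moreover have "\<exists>t>0. \<forall>x y. close_or_far t x y \<longrightarrow> (SUP g\<in>G. osc \<omega> x y g) < ennreal \<epsilon>"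
    if \<epsilon>: "0 < \<epsilon>" for \<epsilon>
  proof -
    \<comment> \<open>Halving \<epsilon> provides the strict inequality: termwise bounds give only a
      non-strict bound on the supremum.\<close>
    have \<epsilon>2: "0 < \<epsilon> / 2" using \<epsilon> by simp
    obtain t where t: "0 < t" "\<And>g x y. g \<in> G \<Longrightarrow> close_or_far t x y \<Longrightarrow>
        norm (g x - g y) \<le> \<epsilon> / 2 * \<omega> (norm (x - y))"
      using van[OF \<epsilon>2] by blast
    have "(SUP g\<in>G. osc \<omega> x y g) < ennreal \<epsilon>" if xy: "close_or_far t x y" for x y
    proof -
      have "0 < \<omega> (norm (x - y))"
        using xy by (intro \<omega>) (simp add: close_or_far_def)
      then have "(SUP g\<in>G. osc \<omega> x y g) \<le> ennreal (\<epsilon> / 2)"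
        using t(2)[OF _ xy] \<epsilon>2 by (intro SUP_least) (simp only: osc_le_ennreal_iff less_imp_le)
      also have "\<dots> < ennreal \<epsilon>"
        using \<epsilon> by (simp add: ennreal_less_iff)
      finally show ?thesis .
    qed
    then show ?thesis using t(1) by blast
  qed
  ultimately show ?thesis
    unfolding uniformly_VC_def close_or_far_def[symmetric] by blast
qed

text \<open>With \<open>uniformly_VC_vanishing\<close>, this turns suprema of extended reals into
  pointwise real estimates; the finite supremum itself is the common constant.\<close>

lemma uniformly_VC_holder:
  fixes G :: "('a::real_normed_vector \<Rightarrow> 'b::real_normed_vector) set"
  assumes \<omega>: "\<And>t. 0 < t \<Longrightarrow> 0 < \<omega> t" and G: "uniformly_VC \<omega> G"
  obtains C where "0 \<le> C" "\<And>g x y. g \<in> G \<Longrightarrow> x \<noteq> y \<Longrightarrow> norm (g x - g y) \<le> C * \<omega> (norm (x - y))"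
proof -
  have "(SUP g\<in>G. holder_norm \<omega> g) < \<infinity>"
    using G by (simp add: uniformly_VC_def)
  then obtain C where C: "0 \<le> C" "(SUP g\<in>G. holder_norm \<omega> g) = ennreal C"
    by (cases "SUP g\<in>G. holder_norm \<omega> g") auto
  have "norm (g x - g y) \<le> C * \<omega> (norm (x - y))" if g: "g \<in> G" and ne: "x \<noteq> y" for g x y
  proof -
    have "holder_norm \<omega> g \<le> ennreal C"
      using SUP_upper[OF g, of "holder_norm \<omega>"] by (simp only: C(2))
    then have "\<forall>x y. x \<noteq> y \<longrightarrow> norm (g x - g y) \<le> C * \<omega> (norm (x - y))"
      by (subst (asm) holder_norm_le_iff) (use \<omega> C(1) in auto)
    then show ?thesis using ne by blast
  qed
  then show thesis using that C(1) by blast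
qed

lemma uniformly_VC_vanishing:
  fixes G :: "('a::real_normed_vector \<Rightarrow> 'b::real_normed_vector) set"
  assumes \<omega>: "\<And>t. 0 < t \<Longrightarrow> 0 < \<omega> t" and G: "uniformly_VC \<omega> G" and \<epsilon>: "0 < \<epsilon>"
  obtains t where "0 < t"
    "\<And>g x y. g \<in> G \<Longrightarrow> close_or_far t x y \<Longrightarrow> norm (g x - g y) \<le> \<epsilon> * \<omega> (norm (x - y))"
proof -
  obtain t where t: "0 < t" "\<And>x y. close_or_far t x y \<Longrightarrow> (SUP g\<in>G. osc \<omega> x y g) < ennreal \<epsilon>"
    using G \<epsilon> unfolding uniformly_VC_def close_or_far_def[symmetric] by blast
  have "norm (g x - g y) \<le> \<epsilon> * \<omega> (norm (x - y))" if g: "g \<in> G" and xy: "close_or_far t x y" for g x y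
  proof -
    have "osc \<omega> x y g \<le> ennreal \<epsilon>"
      using SUP_upper[OF g, of "osc \<omega> x y"] t(2)[OF xy] by (meson le_less_trans less_imp_le)
    moreover have "0 < \<omega> (norm (x - y))"
      using xy by (intro \<omega>) (simp add: close_or_far_def)
    ultimately show ?thesis
      using \<epsilon> by (simp only: osc_le_ennreal_iff less_imp_le)
  qed
  then show thesis using that t(1) by blast
qed

subsection \<open>The truncation map\<close>

text \<open>Clamping the ratio to \<open>[0, 1]\<close> merges the three branches of
  \<open>tau\<close> into the single formula
  \<open>(cutoff M x)\<^sup>2 *\<^sub>R x\<close>.\<close>

definition cutoff :: "real \<Rightarrow> 'a::real_normed_vector \<Rightarrow> real"
  where "cutoff M x = max 0 (min 1 ((2 * M - norm x) / M))"

lemma cutoff_nonneg: "0 \<le> cutoff M x"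
  and cutoff_le_1: "cutoff M x \<le> 1"
  by (auto simp: cutoff_def)

lemma tau_eq_cutoff:
  assumes "0 < M"
  shows "tau M x = (cutoff M x)\<^sup>2 *\<^sub>R x"
  using assms by (auto simp: tau_def cutoff_def min_def max_def divide_simps)

lemma cutoff_eq_0: "0 < M \<Longrightarrow> 2 * M \<le> norm x \<Longrightarrow> cutoff M x = 0"
  by (auto simp: cutoff_def max_def min_def divide_simps)

text \<open>Both the norm and clamping to an interval are nonexpansive; only the division by
  \<open>M\<close> remains.\<close>

lemma cutoff_lipschitz:
  assumes "0 < M"
  shows "\<bar>cutoff M x - cutoff M y\<bar> \<le> norm (x - y) / M"
proof -
  have clamp: "\<bar>max 0 (min 1 a) - max 0 (min 1 b)\<bar> \<le> \<bar>a - b\<bar>" for a b :: real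
    by linarith
  have "\<bar>cutoff M x - cutoff M y\<bar> \<le> \<bar>(2 * M - norm x) / M - (2 * M - norm y) / M\<bar>"
    unfolding cutoff_def by (rule clamp)
  also have "\<dots> = \<bar>norm x - norm y\<bar> / M"
    using assms by (simp add: abs_minus_commute flip: diff_divide_distrib)
  also have "\<dots> \<le> norm (x - y) / M"
    using assms norm_triangle_ineq3[of x y] by (intro divide_right_mono) auto
  finally show ?thesis .
qed

text \<open>
  The factor \<open>max (cutoff M x) (cutoff M y)\<close> comes from \<open>a\<^sup>2 - b\<^sup>2 = (a + b) (a - b)\<close> and is what makes
  the truncation flat near the sphere of radius \<open>2 M\<close>.
\<close>

lemma norm_tau_diff_le:
  fixes x y :: "'a::real_normed_vector"
  assumes M: "0 < M"
  shows "norm (tau M x - tau M y) \<le> 5 * max (cutoff M x) (cutoff M y) * norm (x - y)"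
proof -
  \<comment> \<open>The point weighted by the cutoff difference must lie within
    \<open>2 * M\<close>. Interchanging the points covers the other case, and if both lie beyond,
    both images are zero.\<close>
  have main: "norm (tau M x - tau M y) \<le> 5 * max (cutoff M x) (cutoff M y) * norm (x - y)"
    if y: "norm y \<le> 2 * M" for x y :: 'a
  proof -
    let ?a = "cutoff M x" and ?b = "cutoff M y"
    let ?s = "max ?a ?b"
    have a: "0 \<le> ?a" "?a \<le> 1" "0 \<le> ?b" by (rule cutoff_nonneg cutoff_le_1)+
    have "tau M x - tau M y = ?a\<^sup>2 *\<^sub>R (x - y) + ((?a + ?b) * (?a - ?b)) *\<^sub>R y"
      by (simp add: tau_eq_cutoff[OF M] algebra_simps power2_eq_square)
    then have "norm (tau M x - tau M y) \<le> ?a\<^sup>2 * norm (x - y) + (?a + ?b) * (\<bar>?a - ?b\<bar> * norm y)"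
      using norm_triangle_ineq[of "?a\<^sup>2 *\<^sub>R (x - y)" "((?a + ?b) * (?a - ?b)) *\<^sub>R y"] a
      by (simp add: abs_mult mult.assoc)
    \<comment> \<open>The bound on \<open>norm y\<close> cancels the Lipschitz constant
      \<open>1 / M\<close> of the cutoff, so the estimate is uniform in \<open>M\<close>.\<close>
    also have "\<bar>?a - ?b\<bar> * norm y \<le> norm (x - y) / M * (2 * M)"
      using M y cutoff_lipschitz[OF M, of x y] by (intro mult_mono) auto
    also have "norm (x - y) / M * (2 * M) = 2 * norm (x - y)"
      using M by simp
    also have "?a\<^sup>2 * norm (x - y) + (?a + ?b) * (2 * norm (x - y)) = (?a * ?a + 2 * (?a + ?b)) * norm (x - y)"
      by (simp add: algebra_simps power2_eq_square)
    also have "\<dots> \<le> 5 * ?s * norm (x - y)"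
    proof (rule mult_right_mono)
      \<comment> \<open>The constant \<open>5\<close> is \<open>1 + 2 + 2\<close>: the square is at
        most \<open>?a\<close>, and each cutoff is at most \<open>?s\<close>.\<close>
      have "?a * ?a \<le> ?a" using a by (simp add: mult_left_le)
      moreover have "a * a + 2 * (a + b) \<le> 5 * s" if "a * a \<le> a" "a \<le> s" "b \<le> s" for a b s :: real
        using that by argo
      ultimately show "?a * ?a + 2 * (?a + ?b) \<le> 5 * ?s"
        by simp
    qed simp
    finally show ?thesis using a by (simp add: mult_left_mono)
  qed
  consider "norm y \<le> 2 * M" | "norm x \<le> 2 * M" | "2 * M < norm x" "2 * M < norm y"
    by linarith
  then show ?thesis
  proof cases
    case 2
    then show ?thesis using main[of x y] by (simp add: norm_minus_commute max.commute)
  next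
    case 3
    then show ?thesis using M by (simp add: tau_eq_cutoff cutoff_eq_0)
  qed (rule main)
qed

text \<open>The factor \<open>5\<close> is rounded up to the power of two \<open>8\<close>, to match
  the three doublings in \<open>le_8\<close>.\<close>

lemma norm_tau_diff_le':
  assumes "0 < M"
  shows "norm (tau M x - tau M y) \<le> 8 * norm (x - y)"
proof -
  have "max (cutoff M x) (cutoff M y) \<le> 1"
    by (simp add: cutoff_le_1)
  then have "5 * max (cutoff M x) (cutoff M y) * norm (x - y) \<le> 8 * norm (x - y)"
    by (intro mult_right_mono) auto
  then show ?thesis using norm_tau_diff_le[OF assms, of x y] by linarith
qed

lemma norm_tau_le:
  assumes M: "0 < M"
  shows "norm (tau M x) \<le> 2 * M"
proof (cases "norm x \<le> 2 * M")
  case True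
  have "(cutoff M x)\<^sup>2 * norm x \<le> 1 * norm x"
    using cutoff_nonneg[of M x] cutoff_le_1[of M x] by (intro mult_right_mono) (auto simp: power_le_one)
  then show ?thesis using True M by (simp add: tau_eq_cutoff)
next
  case False
  then show ?thesis using M by (simp add: tau_eq_cutoff cutoff_eq_0)
qed

subsection \<open>Doubling moduli\<close>

locale doubling_modulus =
  fixes \<omega> :: "real \<Rightarrow> real" and D :: real
  assumes pos: "\<And>t. t > 0 \<Longrightarrow> \<omega> t > 0"
    and mono: "mono_on {0<..} \<omega>"
    and zero: "(\<omega> \<longlongrightarrow> 0) (at_right 0)"
    and infinity: "filterlim \<omega> at_top at_top"
    and doubling: "\<And>t. t > 0 \<Longrightarrow> \<omega> (2 * t) \<le> D * \<omega> t"
begin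

lemma le: "0 < s \<Longrightarrow> s \<le> t \<Longrightarrow> \<omega> s \<le> \<omega> t"
  using mono by (auto simp: mono_on_def)

lemma D_ge_1: "1 \<le> D"
proof -
  have "\<omega> 1 \<le> D * \<omega> 1"
    using le[of 1 2] doubling[of 1] by simp
  then show ?thesis using pos[of 1] by simp
qed

lemma le_8:
  assumes "0 < t"
  shows "\<omega> (8 * t) \<le> D ^ 3 * \<omega> t"
proof -
  have "\<omega> (8 * t) \<le> D * \<omega> (4 * t)"
    using doubling[of "4 * t"] assms by simp
  also have "\<dots> \<le> D * (D * \<omega> (2 * t))"
    using doubling[of "2 * t"] assms D_ge_1 by (intro mult_left_mono) auto
  also have "\<dots> \<le> D * (D * (D * \<omega> t))"
    using doubling[of t] assms D_ge_1 by (intro mult_left_mono) auto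
  finally show ?thesis by (simp add: power3_eq_cube mult.assoc)
qed

lemma large: obtains R where "0 < R" "\<And>t. R \<le> t \<Longrightarrow> A \<le> \<omega> t"
proof -
  obtain R where "\<And>t. R \<le> t \<Longrightarrow> A \<le> \<omega> t"
    using infinity by (auto simp: filterlim_at_top eventually_at_top_linorder)
  then show thesis using that[of "max R 1"] by auto
qed

lemma small:
  assumes "0 < e"
  obtains r where "0 < r" "\<And>t. 0 < t \<Longrightarrow> t \<le> r \<Longrightarrow> \<omega> t \<le> e"
proof -
  have "\<forall>\<^sub>F t in at_right 0. \<omega> t < e"
    using order_tendstoD(2)[OF zero assms] .
  then obtain r where "0 < r" "\<And>t. 0 < t \<Longrightarrow> t < r \<Longrightarrow> \<omega> t < e"
    by (auto simp: eventually_at_right_field)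
  then show thesis using that[of "r / 2"] by (auto simp: less_imp_le)
qed

text \<open>Continuity comes from \<open>\<omega>\<close> tending to zero at the origin; it is what
  makes the convolutions integrable.\<close>

lemma holder_imp_continuous:
  fixes f :: "'a::real_normed_vector \<Rightarrow> 'b::real_normed_vector"
  assumes C: "\<And>x y. x \<noteq> y \<Longrightarrow> norm (f x - f y) \<le> C * \<omega> (norm (x - y))"
  shows "continuous_on UNIV f"
  unfolding continuous_on_iff
proof (intro ballI allI impI)
  fix x :: 'a and e :: real assume "0 < e"
  \<comment> \<open>\<open>\<bar>C\<bar> + 1\<close> is a positive majorant of \<open>C\<close>,
    whose sign is unspecified; the factor \<open>2\<close> gives the strict inequality.\<close>
  then have "0 < e / (2 * (\<bar>C\<bar> + 1))" by simp
  then obtain r where r: "0 < r" "\<And>t. 0 < t \<Longrightarrow> t \<le> r \<Longrightarrow> \<omega> t \<le> e / (2 * (\<bar>C\<bar> + 1))"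
    using small by blast
  have "dist (f y) (f x) < e" if "dist y x < r" for y
  proof (cases "y = x")
    case False
    then have t: "0 < norm (y - x)" "norm (y - x) \<le> r"
      using that by (auto simp: dist_norm)
    have "norm (f y - f x) \<le> C * \<omega> (norm (y - x))"
      by (rule C[OF False])
    also have "\<dots> \<le> (\<bar>C\<bar> + 1) * \<omega> (norm (y - x))"
      using pos[OF t(1)] by (intro mult_right_mono) auto
    also have "\<dots> \<le> (\<bar>C\<bar> + 1) * (e / (2 * (\<bar>C\<bar> + 1)))"
      using r(2)[OF t] by (intro mult_left_mono) auto
    also have "\<dots> = e / 2"
      by (simp add: divide_simps)
    finally show ?thesis using \<open>0 < e\<close> by (simp add: dist_norm)
  qed (use \<open>0 < e\<close> in simp)
  then show "\<exists>d>0. \<forall>y\<in>UNIV. dist y x < d \<longrightarrow> dist (f y) (f x) < e"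
    using r(1) by blast
qed

text \<open>Monotonicity passes from the image distance to \<open>8 * norm (x - y)\<close>, and
  three doublings remove the \<open>8\<close>. Assuming the bound for this pair only lets
  \<open>C\<close> be either the global constant or a small one.\<close>

lemma holder_tau:
  fixes f :: "'a::real_normed_vector \<Rightarrow> 'b::real_normed_vector"
  assumes M: "0 < M" and C: "0 \<le> C" and ne: "x \<noteq> y"
    and f: "tau M x \<noteq> tau M y \<Longrightarrow> norm (f (tau M x) - f (tau M y)) \<le> C * \<omega> (norm (tau M x - tau M y))"
  shows "norm (f (tau M x) - f (tau M y)) \<le> D ^ 3 * C * \<omega> (norm (x - y))"
proof (cases "tau M x = tau M y")
  case True
  then show ?thesis using C D_ge_1 pos[of "norm (x - y)"] ne by simp
next
  case False
  have "\<omega> (norm (tau M x - tau M y)) \<le> \<omega> (8 * norm (x - y))"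
    using False norm_tau_diff_le'[OF M] by (intro le) auto
  also have "\<dots> \<le> D ^ 3 * \<omega> (norm (x - y))"
    using ne by (intro le_8) auto
  finally have "C * \<omega> (norm (tau M x - tau M y)) \<le> C * (D ^ 3 * \<omega> (norm (x - y)))"
    using C by (rule mult_left_mono)
  then show ?thesis using f[OF False] by (simp add: mult_ac)
qed

section \<open>Stability of uniform vanishing under truncation and averaging\<close>

lemma uniformly_VC_tau:
  fixes G :: "('a::real_normed_vector \<Rightarrow> 'b::real_normed_vector) set"
  assumes G: "uniformly_VC \<omega> G" and L: "0 < L"
  shows "uniformly_VC \<omega> {f \<circ> tau L | f. f \<in> G}"
proof -
  obtain C where C: "0 \<le> C" "\<And>g x y. g \<in> G \<Longrightarrow> x \<noteq> y \<Longrightarrow> norm (g x - g y) \<le> C * \<omega> (norm (x - y))"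
    using uniformly_VC_holder[OF pos G] by blast
  have D3: "0 < D ^ 3" using D_ge_1 by simp
  have H: "norm (f (tau L x) - f (tau L y)) \<le> D ^ 3 * C * \<omega> (norm (x - y))" if "f \<in> G" "x \<noteq> y" for f x y
    using C(2)[OF that(1)] by (intro holder_tau L C that)
  have V: "\<exists>t>0. \<forall>f\<in>G. \<forall>x y. close_or_far t x y \<longrightarrow>
       norm (f (tau L x) - f (tau L y)) \<le> \<epsilon> * \<omega> (norm (x - y))" if "0 < \<epsilon>" for \<epsilon>
  proof -
    \<comment> \<open>Dividing by \<open>D ^ 3\<close> anticipates the loss in
      \<open>holder_tau\<close>.\<close>
    have eps_D3: "0 < \<epsilon> / D ^ 3" using that D3 by simp
    obtain t where t: "0 < t"
      "\<And>g x y. g \<in> G \<Longrightarrow> close_or_far t x y \<Longrightarrow> norm (g x - g y) \<le> \<epsilon> / D ^ 3 * \<omega> (norm (x - y))"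
      using uniformly_VC_vanishing[OF pos G eps_D3] by blast
    \<comment> \<open>\<open>4 * L\<close> bounds the distance between two truncated points. For
      separations from \<open>R\<close> on, the growth of \<open>\<omega>\<close> outweighs the
      global bound for such images.\<close>
    obtain R where R: "0 < R" "\<And>s. R \<le> s \<Longrightarrow> C * \<omega> (4 * L) / \<epsilon> \<le> \<omega> s"
      using large by blast
    \<comment> \<open>\<open>t / 8\<close> makes images of close points closer than
      \<open>t\<close>; \<open>inverse (2 * L + R)\<close> puts a far point at norm above
      \<open>2 * L + R\<close>.\<close>
    define u where "u = min (t / 8) (inverse (2 * L + R))"
    have u: "0 < u" "u \<le> t / 8" "2 * L + R \<le> inverse u"
    proof -
      show "0 < u" using t(1) R(1) L by (auto simp: u_def)
      show "u \<le> t / 8" by (simp add: u_def)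
      have "inverse (inverse (2 * L + R)) \<le> inverse u"
        using \<open>0 < u\<close> by (intro le_imp_inverse_le) (auto simp: u_def)
      then show "2 * L + R \<le> inverse u" by simp
    qed
    have far: "norm (f (tau L x) - f (tau L y)) \<le> \<epsilon> * \<omega> (norm (x - y))"
      if f: "f \<in> G" and ne: "x \<noteq> y" and x: "norm x > inverse u" for f and x y :: 'a
    proof (cases "tau L x = tau L y")
      case True
      then show ?thesis using \<open>0 < \<epsilon>\<close> pos[of "norm (x - y)"] ne by simp
    next
      case False
      \<comment> \<open>The far point is truncated to zero, so distinct images force
        \<open>norm y < 2 * L\<close>, whence the points are at least \<open>R\<close>
        apart.\<close>
      have "tau L x = 0"
        using x u R(1) L by (simp add: tau_eq_cutoff cutoff_eq_0)
      then have "tau L y \<noteq> 0" using False by auto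
      then have "norm y < 2 * L"
        using L cutoff_eq_0[OF L, of y] by (force simp: tau_eq_cutoff)
      then have "R \<le> norm (x - y)"
        using x u norm_triangle_ineq2[of x y] by linarith
      have "norm (tau L x - tau L y) \<le> 4 * L"
        using norm_triangle_ineq4[of "tau L x" "tau L y"] norm_tau_le[OF L, of x] norm_tau_le[OF L, of y] by linarith
      then have "C * \<omega> (norm (tau L x - tau L y)) \<le> C * \<omega> (4 * L)"
        using False C(1) by (intro mult_left_mono le) auto
      also have "\<dots> \<le> \<epsilon> * \<omega> (norm (x - y))"
        using R(2)[OF \<open>R \<le> norm (x - y)\<close>] \<open>0 < \<epsilon>\<close> by (simp add: field_simps)
      finally show ?thesis using C(2)[OF f False] by linarith
    qed
    have "norm (f (tau L x) - f (tau L y)) \<le> \<epsilon> * \<omega> (norm (x - y))"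
      if f: "f \<in> G" and xy: "close_or_far u x y" for f and x y :: 'a
    proof -
      have ne: "x \<noteq> y" using xy by (simp add: close_or_far_def)
      consider "norm (x - y) < u" | "norm x > inverse u" | "norm y > inverse u"
        using xy unfolding close_or_far_def by blast
      then show ?thesis
      proof cases
        case 1
        then have "norm (tau L x - tau L y) < t"
          using norm_tau_diff_le'[OF L, of x y] u by linarith
        then have "norm (f (tau L x) - f (tau L y)) \<le> D ^ 3 * (\<epsilon> / D ^ 3) * \<omega> (norm (x - y))"
          using eps_D3 by (intro holder_tau L ne t(2) f) (auto simp: close_or_far_def)
        then show ?thesis using D3 by simp
      next
        case 2
        then show ?thesis by (rule far[OF f ne])
      next
        case 3
        then show ?thesis using far[OF f ne[symmetric]] by (simp add: norm_minus_commute)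
      qed
    qed
    then show ?thesis using u(1) by blast
  qed
  show ?thesis
  proof (rule uniformly_VC_I[OF pos])
    show "0 \<le> D ^ 3 * C" using D3 C(1) by simp
    show "norm (g x - g y) \<le> D ^ 3 * C * \<omega> (norm (x - y))"
      if "g \<in> {f \<circ> tau L | f. f \<in> G}" "x \<noteq> y" for g x y
      using that H by auto
    show "\<exists>t>0. \<forall>g\<in>{f \<circ> tau L | f. f \<in> G}. \<forall>x y. close_or_far t x y \<longrightarrow>
        norm (g x - g y) \<le> \<epsilon> * \<omega> (norm (x - y))" if "0 < \<epsilon>" for \<epsilon>
    proof -
      obtain t where "0 < t" "\<And>f x y. f \<in> G \<Longrightarrow> close_or_far t x y \<Longrightarrow>
          norm (f (tau L x) - f (tau L y)) \<le> \<epsilon> * \<omega> (norm (x - y))"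
        using V[OF \<open>0 < \<epsilon>\<close>] by blast
      then show ?thesis by (intro exI[of _ t]) auto
    qed
  qed
qed

lemma uniformly_VC_convolution:
  fixes G :: "('a::euclidean_space \<Rightarrow> 'b::banach) set"
  assumes G: "uniformly_VC \<omega> G" and \<eta>: "mollifier r \<eta>" and r: "0 < r"
  shows "uniformly_VC \<omega> ((\<lambda>g. convolution g \<eta>) ` G)"
proof -
  obtain C where C: "0 \<le> C" "\<And>g x y. g \<in> G \<Longrightarrow> x \<noteq> y \<Longrightarrow> norm (g x - g y) \<le> C * \<omega> (norm (x - y))"
    using uniformly_VC_holder[OF pos G] by blast
  \<comment> \<open>Serves twice: with \<open>B = C\<close> for the global bound and with
    \<open>B = \<epsilon>\<close> for the vanishing.\<close>
  have le: "norm (convolution g \<eta> x - convolution g \<eta> y) \<le> B * \<omega> (norm (x - y))"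
    if g: "g \<in> G" and B: "0 \<le> B" and ne: "x \<noteq> y"
      and "\<And>z. norm z \<le> r \<Longrightarrow> norm (g (x - z) - g (y - z)) \<le> B * \<omega> (norm ((x - z) - (y - z)))" for g B x y
    using that pos[of "norm (x - y)"]
    by (intro norm_convolution_diff_le[OF \<eta> holder_imp_continuous[of g C]] C) auto
  have H: "norm (convolution g \<eta> x - convolution g \<eta> y) \<le> C * \<omega> (norm (x - y))" if "g \<in> G" "x \<noteq> y" for g x y
    using that by (intro le C) auto
  have V: "\<exists>t>0. \<forall>g\<in>G. \<forall>x y. close_or_far t x y \<longrightarrow>
       norm (convolution g \<eta> x - convolution g \<eta> y) \<le> \<epsilon> * \<omega> (norm (x - y))" if \<epsilon>: "0 < \<epsilon>" for \<epsilon>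
  proof -
    obtain t where t: "0 < t"
      "\<And>g x y. g \<in> G \<Longrightarrow> close_or_far t x y \<Longrightarrow> norm (g x - g y) \<le> \<epsilon> * \<omega> (norm (x - y))"
      using uniformly_VC_vanishing[OF pos G \<epsilon>] by blast
    \<comment> \<open>Adding \<open>r\<close> to the threshold keeps \<open>x - z\<close> beyond
      \<open>inverse t\<close> for every \<open>z\<close> in the ball supporting the
      mollifier.\<close>
    define u where "u = inverse (inverse t + r)"
    have u: "0 < u" "u \<le> t" "inverse u = inverse t + r"
    proof -
      show "0 < u" using t(1) r by (simp add: u_def add_pos_pos)
      have "u \<le> inverse (inverse t)"
        unfolding u_def using t(1) r by (intro le_imp_inverse_le) auto
      then show "u \<le> t" by simp
    qed (simp add: u_def)
    have "norm (convolution g \<eta> x - convolution g \<eta> y) \<le> \<epsilon> * \<omega> (norm (x - y))"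
      if g: "g \<in> G" and xy: "close_or_far u x y" for g x y
    proof (rule le[OF g])
      fix z :: 'a assume z: "norm z \<le> r"
      have "close_or_far t (x - z) (y - z)"
        using xy u z norm_triangle_ineq2[of x z] norm_triangle_ineq2[of y z]
        by (auto simp: close_or_far_def)
      then show "norm (g (x - z) - g (y - z)) \<le> \<epsilon> * \<omega> (norm ((x - z) - (y - z)))"
        by (rule t(2)[OF g])
    qed (use \<epsilon> xy in \<open>simp_all add: close_or_far_def\<close>)
    then show ?thesis using u(1) by blast
  qed
  show ?thesis
  proof (rule uniformly_VC_I[OF pos C(1)])
    show "norm (h x - h y) \<le> C * \<omega> (norm (x - y))"
      if "h \<in> (\<lambda>g. convolution g \<eta>) ` G" "x \<noteq> y" for h x y
      using that H by auto
    show "\<exists>t>0. \<forall>h\<in>(\<lambda>g. convolution g \<eta>) ` G. \<forall>x y. close_or_far t x y \<longrightarrow>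
        norm (h x - h y) \<le> \<epsilon> * \<omega> (norm (x - y))" if "0 < \<epsilon>" for \<epsilon>
      unfolding ball_simps using V[OF that] by blast
  qed
qed

section \<open>Approximation by truncation and by mollification\<close>

lemma holder_norm_diff_tau:
  fixes G :: "('a::real_normed_vector \<Rightarrow> 'b::real_normed_vector) set"
  assumes G: "uniformly_VC \<omega> G" and \<epsilon>: "0 < \<epsilon>"
  shows "\<forall>\<^sub>F M in at_top. (SUP f\<in>G. holder_norm \<omega> (\<lambda>x. f x - (f \<circ> tau M) x)) \<le> ennreal \<epsilon>"
proof -
  obtain C where C: "0 \<le> C" "\<And>g x y. g \<in> G \<Longrightarrow> x \<noteq> y \<Longrightarrow> norm (g x - g y) \<le> C * \<omega> (norm (x - y))"
    using uniformly_VC_holder[OF pos G] by blast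
  have D3: "1 \<le> D ^ 3" using D_ge_1 by simp
  \<comment> \<open>The truncated part loses the factor \<open>D ^ 3\<close> and is left with half
    of \<epsilon>; the other half is for \<open>f\<close> itself.\<close>
  define e where "e = \<epsilon> / (2 * D ^ 3)"
  have e: "0 < e" "D ^ 3 * e = \<epsilon> / 2"
    using \<epsilon> D_ge_1 by (auto simp: e_def)
  have "e \<le> \<epsilon> / 2" using mult_right_mono[OF D3, of e] e by simp
  obtain t where t: "0 < t"
    "\<And>g x y. g \<in> G \<Longrightarrow> close_or_far t x y \<Longrightarrow> norm (g x - g y) \<le> e * \<omega> (norm (x - y))"
    using uniformly_VC_vanishing[OF pos G e(1)] by blast
  \<comment> \<open>Images in the ball of radius \<open>inverse t\<close> are at most
    \<open>2 * inverse t\<close> apart; a separation of \<open>R\<close> compensates for the global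
    bound on such pairs.\<close>
  obtain R where R: "0 < R" "\<And>s. R \<le> s \<Longrightarrow> C * \<omega> (2 * inverse t) / (\<epsilon> / 2) \<le> \<omega> s"
    using large by blast
  \<comment> \<open>The first threshold keeps a point outside radius \<open>M\<close> at distance
    \<open>R\<close> from the ball of radius \<open>inverse t\<close>; the second comes from the
    flatness of \<open>tau M\<close>.\<close>
  have "(SUP f\<in>G. holder_norm \<omega> (\<lambda>x. f x - (f \<circ> tau M) x)) \<le> ennreal \<epsilon>"
    if M: "inverse t + R < M" "25 * R\<^sup>2 / t ^ 3 < M" for M
  proof (rule SUP_least)
    fix f assume f: "f \<in> G"
    have "0 < inverse t" using t(1) by simp
    then have M0: "0 < M" "inverse t < M" using M R(1) by linarith+
    \<comment> \<open>Image pairs without small oscillation come from points at least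
      \<open>R\<close> apart: either \<open>y\<close> is its own image, or both points lie where the
      truncation is too flat to spread points closer than \<open>R\<close> over distance
      \<open>t\<close>.\<close>
    have dist_large: "R \<le> norm (x - y)"
      if x: "M \<le> norm x" and small: "norm (tau M x) \<le> inverse t" "norm (tau M y) \<le> inverse t"
        and t_le: "t \<le> norm (tau M x - tau M y)" for x y :: 'a
    proof (cases "norm y < M")
      case True
      then have "norm y \<le> inverse t" using small(2) by (simp add: tau_def)
      then show ?thesis using M(1) x norm_triangle_ineq2[of x y] by linarith
    next
      case False
      \<comment> \<open>The image has norm \<open>(cutoff M w)\<^sup>2 * norm w\<close>, so for
        \<open>norm w\<close> at least \<open>M\<close> it can be small only if the cutoff
        is.\<close>
      have cut: "(cutoff M w)\<^sup>2 \<le> inverse (t * M)" if "M \<le> norm w" "norm (tau M w) \<le> inverse t" for w :: 'a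
      proof -
        have "(cutoff M w)\<^sup>2 * M \<le> (cutoff M w)\<^sup>2 * norm w"
          using that(1) by (intro mult_left_mono) auto
        also have "\<dots> \<le> inverse t"
          using that(2) M0 by (simp add: tau_eq_cutoff)
        finally show ?thesis using M0 t(1) by (simp add: field_simps)
      qed
      let ?s = "max (cutoff M x) (cutoff M y)"
      have s: "0 \<le> ?s" "?s\<^sup>2 \<le> inverse (t * M)"
        using cut[OF x small(1)] cut[of y] False small(2) cutoff_nonneg[of M x] by (auto simp: max_def)
      show ?thesis
      proof (rule ccontr)
        assume "\<not> R \<le> norm (x - y)"
        \<comment> \<open>Squaring brings in the bound on \<open>?s\<^sup>2\<close> and yields
          \<open>t ^ 3 * M \<le> 25 * R\<^sup>2\<close>, against the choice of
          \<open>M\<close>.\<close>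
        then have "t \<le> 5 * ?s * R"
          using t_le norm_tau_diff_le[OF M0(1), of x y] s(1)
            mult_left_mono[of "norm (x - y)" R "5 * ?s"] by linarith
        then have "t\<^sup>2 \<le> (5 * ?s * R)\<^sup>2"
          using t(1) by (intro power_mono) auto
        also have "\<dots> = ?s\<^sup>2 * (25 * R\<^sup>2)"
          by (simp add: power_mult_distrib)
        also have "\<dots> \<le> inverse (t * M) * (25 * R\<^sup>2)"
          using s(2) by (intro mult_right_mono) auto
        finally have "t ^ 3 * M \<le> 25 * R\<^sup>2"
          using t(1) M0 by (simp add: field_simps power2_eq_square power3_eq_cube)
        then show False
          using M(2) t(1) by (simp add: field_simps)
      qed
    qed
    have main: "norm ((f x - f (tau M x)) - (f y - f (tau M y))) \<le> \<epsilon> * \<omega> (norm (x - y))"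
      if ne: "x \<noteq> y" and x: "M \<le> norm x" for x y :: 'a
    proof -
      have \<omega>xy: "0 < \<omega> (norm (x - y))" using ne by (intro pos) simp
      have "norm (f x - f y) \<le> e * \<omega> (norm (x - y))"
        using x M0 ne by (intro t(2) f) (simp add: close_or_far_def)
      also have "\<dots> \<le> \<epsilon> / 2 * \<omega> (norm (x - y))"
        using \<omega>xy \<open>e \<le> \<epsilon> / 2\<close> by (intro mult_right_mono) auto
      finally have 1: "norm (f x - f y) \<le> \<epsilon> / 2 * \<omega> (norm (x - y))" .
      have 2: "norm (f (tau M x) - f (tau M y)) \<le> \<epsilon> / 2 * \<omega> (norm (x - y))"
      proof (cases "tau M x \<noteq> tau M y \<and> t \<le> norm (tau M x - tau M y) \<and>
          norm (tau M x) \<le> inverse t \<and> norm (tau M y) \<le> inverse t")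
        case True
        then have "R \<le> norm (x - y)" by (intro dist_large x) auto
        have "norm (tau M x - tau M y) \<le> 2 * inverse t"
          using True norm_triangle_ineq4[of "tau M x" "tau M y"] by linarith
        then have "C * \<omega> (norm (tau M x - tau M y)) \<le> C * \<omega> (2 * inverse t)"
          using True C(1) by (intro mult_left_mono le) auto
        also have "\<dots> \<le> \<epsilon> / 2 * \<omega> (norm (x - y))"
          using R(2)[OF \<open>R \<le> norm (x - y)\<close>] \<epsilon> by (simp add: field_simps)
        finally show ?thesis using C(2)[OF f] True by force
      next
        \<comment> \<open>The images coincide or are \<open>close_or_far t\<close>;
          \<open>holder_tau\<close> covers both situations.\<close>
        case False
        then have "norm (f (tau M x) - f (tau M y)) \<le> D ^ 3 * e * \<omega> (norm (x - y))"
          using e(1) by (intro holder_tau M0 ne t(2) f) (auto simp: close_or_far_def)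
        then show ?thesis by (simp add: e(2))
      qed
      show ?thesis
        using 1 2 norm_triangle_ineq4[of "f x - f y" "f (tau M x) - f (tau M y)"]
        by (simp add: algebra_simps)
    qed
    have "norm ((f x - f (tau M x)) - (f y - f (tau M y))) \<le> \<epsilon> * \<omega> (norm (x - y))" if ne: "x \<noteq> y" for x y :: 'a
    proof -
      consider "M \<le> norm x" | "M \<le> norm y" | "norm x < M" "norm y < M" by linarith
      then show ?thesis
      proof cases
        case 2
        then show ?thesis using main[OF ne[symmetric]] by (simp add: norm_minus_commute)
      next
        \<comment> \<open>Inside radius \<open>M\<close> the truncation is the identity, so both
          errors vanish.\<close>
        case 3
        then show ?thesis using pos[of "norm (x - y)"] ne \<epsilon> by (simp add: tau_def)
      qed (rule main[OF ne])
    qed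
    then show "holder_norm \<omega> (\<lambda>x. f x - (f \<circ> tau M) x) \<le> ennreal \<epsilon>"
      using \<epsilon> pos by (subst holder_norm_le_iff) auto
  qed
  then show ?thesis
    using eventually_conj[OF eventually_gt_at_top[of "inverse t + R"] eventually_gt_at_top[of "25 * R\<^sup>2 / t ^ 3"]]
    by (auto elim: eventually_mono)
qed

text \<open>Separations are split at \<open>t\<close>: below it the uniform bound applies to
  \<open>g\<close> and to its average, from \<open>t\<close> on each pointwise error is small
  compared with \<open>\<omega> t\<close>.\<close>

lemma holder_norm_diff_convolution:
  fixes G :: "('a::euclidean_space \<Rightarrow> 'b::banach) set"
  assumes G: "uniformly_VC \<omega> G" and \<eta>: "\<And>r. 0 < r \<Longrightarrow> mollifier r (\<eta> r)" and \<epsilon>: "0 < \<epsilon>"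
  shows "\<forall>\<^sub>F r in at_right 0. (SUP g\<in>G. holder_norm \<omega> (\<lambda>x. g x - convolution g (\<eta> r) x)) \<le> ennreal \<epsilon>"
proof -
  obtain C where C: "0 \<le> C" "\<And>g x y. g \<in> G \<Longrightarrow> x \<noteq> y \<Longrightarrow> norm (g x - g y) \<le> C * \<omega> (norm (x - y))"
    using uniformly_VC_holder[OF pos G] by blast
  obtain t where t: "0 < t"
    "\<And>g x y. g \<in> G \<Longrightarrow> close_or_far t x y \<Longrightarrow> norm (g x - g y) \<le> \<epsilon> / 2 * \<omega> (norm (x - y))"
    using uniformly_VC_vanishing[OF pos G half_gt_zero[OF \<epsilon>]] by blast
  \<comment> \<open>\<open>C + 1\<close> keeps the quotient positive when
    \<open>C = 0\<close>.\<close>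
  have "0 < \<epsilon> / 2 * \<omega> t / (C + 1)"
    using \<epsilon> C(1) pos[OF t(1)] by simp
  then obtain r0 where r0: "0 < r0" "\<And>r. 0 < r \<Longrightarrow> r \<le> r0 \<Longrightarrow> \<omega> r \<le> \<epsilon> / 2 * \<omega> t / (C + 1)"
    using small by blast
  have "(SUP g\<in>G. holder_norm \<omega> (\<lambda>x. g x - convolution g (\<eta> r) x)) \<le> ennreal \<epsilon>"
    if r: "0 < r" "r < r0" for r
  proof (rule SUP_least)
    fix g assume g: "g \<in> G"
    have cont: "continuous_on UNIV g"
      using C(2)[OF g] by (rule holder_imp_continuous)
    have "norm ((g x - convolution g (\<eta> r) x) - (g y - convolution g (\<eta> r) y)) \<le> \<epsilon> * \<omega> (norm (x - y))"
      if ne: "x \<noteq> y" for x y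
    proof (cases "norm (x - y) < t")
      case True
      have \<omega>xy: "0 < \<omega> (norm (x - y))" using ne by (intro pos) simp
      have "norm (g (x - z) - g (y - z)) \<le> \<epsilon> / 2 * \<omega> (norm (x - y))" for z
        using t(2)[OF g, of "x - z" "y - z"] True ne by (simp add: close_or_far_def)
      then have "norm (convolution g (\<eta> r) x - convolution g (\<eta> r) y) \<le> \<epsilon> / 2 * \<omega> (norm (x - y))"
        using \<epsilon> \<omega>xy by (intro norm_convolution_diff_le[OF \<eta>[OF r(1)] cont]) auto
      moreover have "norm (g x - g y) \<le> \<epsilon> / 2 * \<omega> (norm (x - y))"
        using True ne by (intro t(2)[OF g]) (simp add: close_or_far_def)
      ultimately show ?thesis
        using norm_triangle_ineq4[of "g x - g y" "convolution g (\<eta> r) x - convolution g (\<eta> r) y"]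
        by (simp add: algebra_simps)
    next
      case False
      \<comment> \<open>A shift by at most \<open>r\<close> changes \<open>g\<close> by at most
        \<open>C * \<omega> r\<close>, which the choice of \<open>r0\<close> controls at every
        point; monotonicity then replaces \<open>t\<close> by \<open>norm (x - y)\<close>.\<close>
      have B: "norm (g w - convolution g (\<eta> r) w) \<le> \<epsilon> / 2 * \<omega> t" for w
      proof (rule norm_diff_convolution_le[OF \<eta>[OF r(1)] cont])
        show "norm (g w - g (w - z)) \<le> \<epsilon> / 2 * \<omega> t" if z: "norm z \<le> r" for z
        \<comment> \<open>The bound by \<open>C\<close> covers distinct points only, and
          \<open>\<omega> 0\<close> is unspecified.\<close>
        proof (cases "z = 0")
          case False
          have "norm (g w - g (w - z)) \<le> C * \<omega> (norm z)"
            using C(2)[OF g, of w "w - z"] False by simp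
          also have "\<dots> \<le> (C + 1) * (\<epsilon> / 2 * \<omega> t / (C + 1))"
            using r0(2)[of "norm z"] False z r C(1) pos[of "norm z"] by (intro mult_mono) auto
          also have "\<dots> = \<epsilon> / 2 * \<omega> t"
            using C(1) by (simp add: field_simps)
          finally show ?thesis .
        qed (use \<epsilon> pos[OF t(1)] in simp)
      qed (use \<epsilon> pos[OF t(1)] in simp)
      have "\<epsilon> * \<omega> t \<le> \<epsilon> * \<omega> (norm (x - y))"
        using \<epsilon> t(1) False by (intro mult_left_mono le) auto
      then show ?thesis
        using B[of x] B[of y] norm_triangle_ineq4[of "g x - convolution g (\<eta> r) x" "g y - convolution g (\<eta> r) y"]
        by linarith
    qed
    then show "holder_norm \<omega> (\<lambda>x. g x - convolution g (\<eta> r) x) \<le> ennreal \<epsilon>"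
      using \<epsilon> pos by (subst holder_norm_le_iff) auto
  qed
  then show ?thesis
    using r0(1) by (auto simp: eventually_at_right_field)
qed

end

section \<open>Assembly of the four claims\<close>

theorem corollary2p5:
  fixes \<omega> :: "real \<Rightarrow> real" and C_db :: real
    and G :: "(real ^ 'n \<Rightarrow> 'b::banach) set"
    and \<eta> :: "real \<Rightarrow> real ^ 'n \<Rightarrow> real"
  assumes \<omega>_pos: "\<And>t. t > 0 \<Longrightarrow> \<omega> t > 0"
    and \<omega>_mono: "mono_on {0<..} \<omega>"
    and \<omega>_zero: "(\<omega> \<longlongrightarrow> 0) (at_right 0)"
    and \<omega>_infinity: "filterlim \<omega> at_top at_top"
    and C_db: "C_db > 1"
    and doubling: "\<And>t. t > 0 \<Longrightarrow> \<omega> (2 * t) \<le> C_db * \<omega> t"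
    and \<eta>: "\<And>r. r > 0 \<Longrightarrow> mollifier r (\<eta> r)"
    and G: "uniformly_VC \<omega> G"
  shows "(\<forall>L>0. uniformly_VC \<omega> {f \<circ> tau L | f. f \<in> G})
    \<and> (\<forall>L>0. \<forall>L'>0. uniformly_VC \<omega> {convolution (f \<circ> tau L) (\<eta> L') | f. f \<in> G})
    \<and> (\<forall>\<epsilon>::real. \<epsilon> > 0 \<longrightarrow> (\<forall>\<^sub>F M in at_top.
          (SUP f\<in>G. holder_norm \<omega> (\<lambda>x. f x - (f \<circ> tau M) x)) \<le> ennreal \<epsilon>))
    \<and> (\<forall>\<epsilon>::real. \<epsilon> > 0 \<longrightarrow> (\<forall>M>0. \<forall>\<^sub>F K in at_top.
          (SUP f\<in>G. holder_norm \<omega> (\<lambda>x. (f \<circ> tau M) x - convolution (f \<circ> tau M) (\<eta> (1 / K)) x))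
            \<le> ennreal \<epsilon>))"
proof -
  interpret doubling_modulus \<omega> C_db
    by standard (fact \<omega>_pos \<omega>_mono \<omega>_zero \<omega>_infinity doubling)+
  have tau: "uniformly_VC \<omega> {f \<circ> tau L | f. f \<in> G}" if "0 < L" for L
    by (rule uniformly_VC_tau[OF G that])
  show ?thesis
  proof (intro conjI allI impI)
    show "uniformly_VC \<omega> {convolution (f \<circ> tau L) (\<eta> L') | f. f \<in> G}" if "0 < L" "0 < L'" for L L'
    proof -
      have "{convolution (f \<circ> tau L) (\<eta> L') | f. f \<in> G} =
          (\<lambda>g. convolution g (\<eta> L')) ` {f \<circ> tau L | f. f \<in> G}"
        by blast
      then show ?thesis
        using uniformly_VC_convolution[OF tau[OF that(1)] \<eta>[OF that(2)] that(2)] by simp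
    qed
    show "\<forall>\<^sub>F K in at_top.
        (SUP f\<in>G. holder_norm \<omega> (\<lambda>x. (f \<circ> tau M) x - convolution (f \<circ> tau M) (\<eta> (1 / K)) x)) \<le> ennreal \<epsilon>"
      if "0 < \<epsilon>" "0 < M" for \<epsilon> M
    proof -
      \<comment> \<open>\<open>K\<close> enters as the mollifier radius \<open>1 / K\<close>, which
        tends to zero from the right.\<close>
      have "filterlim (\<lambda>K::real. 1 / K) (at_right 0) at_top"
        using filterlim_inverse_at_right_top by (simp add: inverse_eq_divide)
      then have "\<forall>\<^sub>F K in at_top. (SUP g\<in>{f \<circ> tau M | f. f \<in> G}.
          holder_norm \<omega> (\<lambda>x. g x - convolution g (\<eta> (1 / K)) x)) \<le> ennreal \<epsilon>"
        using holder_norm_diff_convolution[OF tau[OF that(2)] \<eta> that(1)] by (rule eventually_compose_filterlim[rotated])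
      then show ?thesis
        by (simp add: Setcompr_eq_image image_image)
    qed
  qed (rule tau holder_norm_diff_tau[OF G], assumption)+
qed

end
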